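(* Let $n>m\geq 2$ be integers, let $K$ be a field, $S=K[x_1,\ldots,x_n]$, and let $J_{n,m}\subset S$ be the $m$-path ideal of the cycle graph of length $n$. Let $d=\gcd(n,m)$, and let $t_0$ be the maximal integer such that $t_0\leq n-1$ and there exists a positive integer $\alpha$ with $mt_0=\alpha n+d$. Then: (1) If $d=1$, then $\operatorname{sdepth}(S/J_{n,m}^t)=\operatorname{depth}(S/J_{n,m}^t)=0$ for all $t\geq t_0$. (2) If $d>1$, then $\operatorname{depth}(S/J_{n,m}^t)\leq d-1$ for all $t\geq t_0$. (3) If $d>1$, then $\operatorname{sdepth}(S/J_{n,m}^t)\leq \operatorname{sdepth}(S/U_{n,d})\leq n-\frac{n}{d}$ for all $t\geq t_0$.
   Context: The $m$-path ideal of the cycle graph of length $n$ is the monomial ideal $J_{n,m}\subset S$ generated by the $n$ monomials $x_ix_{i+1}\cdots x_{i+m-1}$, $1\leq i\leq n$, where indices are read modulo $n$ in $\{1,\ldots,n\}$; that is, $J_{n,m}=(x_1\cdots x_m,\ x_2\cdots x_{m+1},\ \ldots,\ x_{n-m+1}\cdots x_n,\ x_{n-m+2}\cdots x_nx_1,\ \ldots,\ x_nx_1\cdots x_{m-1})$. With $r=\frac{n}{d}$ and $d>1$, $U_{n,d}=(x_1,x_{d+1},\ldots,x_{d(r-1)+1})\cap (x_2,x_{d+2},\ldots,x_{d(r-1)+2})\cap\cdots\cap (x_d,x_{2d},\ldots,x_{rd})\subset S$, i.e. the intersection over $1\leq j\leq d$ of the ideals generated by the variables whose index is congruent to $j$ modulo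 $d$. Depth is taken with respect to the graded maximal ideal $(x_1,\ldots,x_n)$. For a $\mathbb Z^n$-graded $S$-module $M$, a Stanley decomposition $\mathcal D$ of $M$ is a direct sum decomposition $M=\bigoplus_{i=1}^r m_iK[Z_i]$ as a $\mathbb Z^n$-graded $K$-vector space, where each $m_i\in M$ is $\mathbb Z^n$-homogeneous, $Z_i\subset\{x_1,\ldots,x_n\}$, and $m_iK[Z_i]=\{um_i: u\in K[Z_i]\}$ is a free $K[Z_i]$-submodule of $M$. Put $\operatorname{sdepth}(\mathcal D)=\min_i|Z_i|$; the Stanley depth $\operatorname{sdepth}(M)$ is the maximum of $\operatorname{sdepth}(\mathcal D)$ over all Stanley decompositions $\mathcal D$ of $M$. *)

theory Defs
  imports
    "HOL-Library.Poly_Mapping"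
    "HOL-Library.Extended_Nat"
    "HOL-Algebra.Ideal_Product"
    "HOL-Algebra.QuotRing"
    "HOL-Algebra.Module"
begin

section \<open>The polynomial ring\<close>

text \<open>
  Exponent vectors are finitely supported functions on the variable indices. The type provides
  infinitely many variables; the ring in the variables with index in \<open>Z\<close> is the carrier
  \<open>mpolys Z\<close>, so that $K[x_1,\ldots,x_n]$ is \<open>mpoly_ring n\<close>.
\<close>

type_synonym 'k mpoly = "(nat \<Rightarrow>\<^sub>0 nat) \<Rightarrow>\<^sub>0 'k"

definition mpolys :: "nat set \<Rightarrow> 'k::field mpoly set"
  where "mpolys Z = {p. \<forall>b \<in> Poly_Mapping.keys p. Poly_Mapping.keys b \<subseteq> Z}"

definition mpoly_ring :: "nat \<Rightarrow> 'k::field mpoly ring"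
  where "mpoly_ring n =
    \<lparr>carrier = mpolys {1..n}, monoid.mult = (*), one = 1, ring.zero = 0, ring.add = (+)\<rparr>"

definition mvar :: "nat \<Rightarrow> 'k::field mpoly"
  where "mvar i = Poly_Mapping.single (Poly_Mapping.single i 1) 1"

definition max_ideal :: "nat \<Rightarrow> 'k::field mpoly set"
  where "max_ideal n = Idl\<^bsub>mpoly_ring n\<^esub> (mvar ` {1..n})"


section \<open>The ideals\<close>

text \<open>The representative of \<open>i + k\<close> modulo \<open>n\<close> in \<open>{1..n}\<close> is \<open>(i + k - 1) mod n + 1\<close>.\<close>

definition cycle_path_ideal :: "nat \<Rightarrow> nat \<Rightarrow> 'k::field mpoly set"
  where "cycle_path_ideal n m =
    Idl\<^bsub>mpoly_ring n\<^esub> ((\<lambda>i. \<Prod>k<m. mvar ((i + k - 1) mod n + 1)) ` {1..n})"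

definition residue_class_ideal :: "nat \<Rightarrow> nat \<Rightarrow> 'k::field mpoly set"
  where "residue_class_ideal n d =
    (\<Inter>j\<in>{1..d}. Idl\<^bsub>mpoly_ring n\<^esub> ((\<lambda>i. mvar (d * i + j)) ` {..<n div d}))"

definition ideal_power :: "('a, 'c) ring_scheme \<Rightarrow> 'a set \<Rightarrow> nat \<Rightarrow> 'a set"
  where "ideal_power R I t = I [^]\<^bsub>ideals_set R\<^esub> t"

definition quotient_module :: "('a, 'c) ring_scheme \<Rightarrow> 'a set \<Rightarrow> ('a, 'a set) module"
  where "quotient_module R I =
    ring.extend (R Quot I) \<lparr>smult = (\<lambda>a X. (I +>\<^bsub>R\<^esub> a) \<otimes>\<^bsub>R Quot I\<^esub> X)\<rparr>"


section \<open>Depth\<close>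

text \<open>The submodule $(f_1,\ldots,f_s)M$.\<close>

definition list_smult_module ::
    "('a, 'b, 'c) module_scheme \<Rightarrow> 'a list \<Rightarrow> 'b set"
  where "list_smult_module M fs =
    {(\<Oplus>\<^bsub>M\<^esub>i\<in>{..<length fs}. (fs ! i) \<odot>\<^bsub>M\<^esub> u i) | u. u \<in> {..<length fs} \<rightarrow> carrier M}"

text \<open>
  In \<open>regular_sequence\<close> the second condition says that \<open>fs ! i\<close> is a non-zero-divisor on the
  quotient of \<open>M\<close> by the submodule generated by the preceding elements times \<open>M\<close>.
\<close>

definition regular_sequence ::
    "('a, 'e) ring_scheme \<Rightarrow> ('a, 'b, 'c) module_scheme \<Rightarrow> 'a list \<Rightarrow> bool"
  where "regular_sequence R M fs \<longleftrightarrow>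
    set fs \<subseteq> carrier R \<and>
    (\<forall>i<length fs. \<forall>v\<in>carrier M.
      (fs ! i) \<odot>\<^bsub>M\<^esub> v \<in> list_smult_module M (take i fs) \<longrightarrow>
      v \<in> list_smult_module M (take i fs)) \<and>
    list_smult_module M fs \<noteq> carrier M"

definition depth ::
    "('a, 'e) ring_scheme \<Rightarrow> 'a set \<Rightarrow> ('a, 'b, 'c) module_scheme \<Rightarrow> enat"
  where "depth R \<aa> M =
    (SUP fs\<in>{fs. set fs \<subseteq> \<aa> \<and> regular_sequence R M fs}. enat (length fs))"


section \<open>Stanley depth\<close>

text \<open>
  \<open>G a\<close> is the homogeneous component of degree \<open>a\<close> of a graded module \<open>M\<close> over \<open>mpoly_ring n\<close>;
  only the values of a degree \<open>a\<close> on \<open>{1..n}\<close> matter. A decomposition is given by the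
  list of its pairs $(m_i, Z_i)$, where \<open>Z\<^sub>i\<close> is represented by the set of indices of its variables.
\<close>

definition stanley_space ::
    "('k::field mpoly, 'b, 'c) module_scheme \<Rightarrow> 'b \<times> nat set \<Rightarrow> 'b set"
  where "stanley_space M vZ = (\<lambda>u. u \<odot>\<^bsub>M\<^esub> fst vZ) ` mpolys (snd vZ)"

definition stanley_decomposition ::
    "nat \<Rightarrow> ('k::field mpoly, 'b, 'c) module_scheme \<Rightarrow> ((nat \<Rightarrow> int) \<Rightarrow> 'b set) \<Rightarrow>
     ('b \<times> nat set) list \<Rightarrow> bool"
  where "stanley_decomposition n M G D \<longleftrightarrow>
    (\<forall>(v, Z)\<in>set D. v \<in> carrier M \<and> (\<exists>a. v \<in> G a) \<and> Z \<subseteq> {1..n} \<and>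
      (\<forall>u\<in>mpolys Z. u \<odot>\<^bsub>M\<^esub> v = \<zero>\<^bsub>M\<^esub> \<longrightarrow> u = 0)) \<and>
    (\<forall>w\<in>carrier M. \<exists>!f. f \<in> (\<Pi>\<^sub>E j\<in>{..<length D}. stanley_space M (D ! j)) \<and>
      w = (\<Oplus>\<^bsub>M\<^esub>j\<in>{..<length D}. f j))"

definition decomposition_sdepth :: "('b \<times> nat set) list \<Rightarrow> enat"
  where "decomposition_sdepth D = (INF vZ\<in>set D. enat (card (snd vZ)))"

text \<open>
  For \<open>M \<noteq> 0\<close> every decomposition is non-empty and the supremum ranges over numbers that are at
  most \<open>n\<close>, hence it is a maximum.
\<close>

definition sdepth ::
    "nat \<Rightarrow> ('k::field mpoly, 'b, 'c) module_scheme \<Rightarrow> ((nat \<Rightarrow> int) \<Rightarrow> 'b set) \<Rightarrow> enat"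
  where "sdepth n M G = (SUP D\<in>{D. stanley_decomposition n M G D}. decomposition_sdepth D)"


section \<open>Depth and Stanley depth of \<open>S/I\<close>\<close>

text \<open>
  The component of degree \<open>a\<close> of $S/I$ is the image of that of $S$, which is zero if \<open>a\<close> has a
  negative entry. This is a grading if \<open>I\<close> is a monomial ideal.
\<close>

definition quotient_grading :: "nat \<Rightarrow> 'k::field mpoly set \<Rightarrow> (nat \<Rightarrow> int) \<Rightarrow> 'k mpoly set set"
  where "quotient_grading n I a =
    {I +>\<^bsub>mpoly_ring n\<^esub> p | p. p \<in> carrier (mpoly_ring n) \<and>
      (\<forall>b\<in>Poly_Mapping.keys p. \<forall>i\<in>{1..n}. int (Poly_Mapping.lookup b i) = a i)}"

definition quotient_depth :: "nat \<Rightarrow> 'k::field mpoly set \<Rightarrow> enat"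
  where "quotient_depth n I =
    depth (mpoly_ring n) (max_ideal n) (quotient_module (mpoly_ring n) I)"

definition quotient_sdepth :: "nat \<Rightarrow> 'k::field mpoly set \<Rightarrow> enat"
  where "quotient_sdepth n I =
    sdepth n (quotient_module (mpoly_ring n) I) (quotient_grading n I)"


section \<open>Well-definedness\<close>

lemma keys_times_mpolys:
  fixes p q :: "'k::field mpoly"
  assumes "p \<in> mpolys Z" "q \<in> mpolys Z"
  shows "p * q \<in> mpolys Z"
  unfolding mpolys_def
proof (clarify)
  fix b x assume b: "b \<in> Poly_Mapping.keys (p * q)" and x: "x \<in> Poly_Mapping.keys b"
  from b keys_mult[of p q] obtain c e where "b = c + e" "c \<in> Poly_Mapping.keys p"
    "e \<in> Poly_Mapping.keys q" by blast
  with x assms Poly_Mapping.keys_add[of c e] show "x \<in> Z"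
    unfolding mpolys_def by blast
qed

lemma cring_mpoly_ring: "cring (mpoly_ring n :: 'k::field mpoly ring)"
proof (rule cringI)
  show "abelian_group (mpoly_ring n :: 'k mpoly ring)"
  proof (rule abelian_groupI)
    fix x y :: "'k mpoly"
    assume "x \<in> carrier (mpoly_ring n)" "y \<in> carrier (mpoly_ring n)"
    then show "x \<oplus>\<^bsub>mpoly_ring n\<^esub> y \<in> carrier (mpoly_ring n)"
      using Poly_Mapping.keys_add[of x y] by (fastforce simp: mpoly_ring_def mpolys_def)
  next
    fix x :: "'k mpoly" assume "x \<in> carrier (mpoly_ring n)"
    then show "\<exists>y\<in>carrier (mpoly_ring n). y \<oplus>\<^bsub>mpoly_ring n\<^esub> x = \<zero>\<^bsub>mpoly_ring n\<^esub>"
      by (intro bexI[of _ "- x"])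
        (auto simp: mpoly_ring_def mpolys_def in_keys_iff lookup_uminus)
  qed (auto simp: mpoly_ring_def mpolys_def algebra_simps)
  show "comm_monoid (mpoly_ring n :: 'k mpoly ring)"
  proof (rule comm_monoidI)
    fix x y :: "'k mpoly"
    assume "x \<in> carrier (mpoly_ring n)" "y \<in> carrier (mpoly_ring n)"
    then show "x \<otimes>\<^bsub>mpoly_ring n\<^esub> y \<in> carrier (mpoly_ring n)"
      using keys_times_mpolys by (simp add: mpoly_ring_def)
  qed (auto simp: mpoly_ring_def mpolys_def algebra_simps)
qed (auto simp: mpoly_ring_def algebra_simps)

lemma module_quotient_module:
  fixes R (structure)
  assumes "cring R" "ideal I R"
  shows "module R (quotient_module R I)"
proof -
  interpret cring R by fact
  interpret I: ideal I R by fact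
  interpret Q: ring "R Quot I" by (rule I.quotient_is_ring)
  interpret h: ring_hom_ring R "R Quot I" "(+>) I" by (rule I.rcos_ring_hom_ring)
  have sel: "carrier (quotient_module R I) = carrier (R Quot I)"
      "zero (quotient_module R I) = zero (R Quot I)"
      "add (quotient_module R I) = add (R Quot I)"
      "smult (quotient_module R I) = (\<lambda>a X. (I +> a) \<otimes>\<^bsub>R Quot I\<^esub> X)"
    by (simp_all add: quotient_module_def ring.defs)
  show ?thesis
  proof (rule moduleI)
    show "cring R" by fact
    show "abelian_group (quotient_module R I)"
      by (rule abelian_groupI) (simp_all add: sel Q.add.m_ac Q.add.l_inv_ex)
  qed (auto simp: sel Q.l_distr Q.r_distr Q.m_assoc)
qed

lemma ideal_cycle_path_ideal: "ideal (cycle_path_ideal n m) (mpoly_ring n)"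
proof -
  interpret cring "mpoly_ring n" by (rule cring_mpoly_ring)
  have var: "mvar ((i + k - 1) mod n + 1) \<in> mpolys {1..n}" if "i \<in> {1..n}" for i k
  proof -
    have "(i + k - 1) mod n < n" using that by (intro mod_less_divisor) auto
    then show ?thesis by (auto simp: mvar_def mpolys_def)
  qed
  have "(\<Prod>k\<in>A. mvar ((i + k - 1) mod n + 1)) \<in> mpolys {1..n}" if "finite A" "i \<in> {1..n}"
    for A :: "nat set" and i
    using that
  proof (induction A rule: finite_induct)
    case empty
    then show ?case by (simp add: mpolys_def)
  next
    case (insert k A)
    then show ?case
      by (simp only: prod.insert[OF insert.hyps]) (blast intro: keys_times_mpolys var)
  qed
  then have "(\<lambda>i. \<Prod>k<m. mvar ((i + k - 1) mod n + 1)) ` {1..n} \<subseteq> carrier (mpoly_ring n)"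
    unfolding mpoly_ring_def by (simp only: partial_object.simps) blast
  then show ?thesis
    unfolding cycle_path_ideal_def by (rule genideal_ideal)
qed


section \<open>The threshold $t_0$\<close>

definition threshold :: "nat \<Rightarrow> nat \<Rightarrow> nat"
  where "threshold n m =
    Max {t. t \<le> n - 1 \<and> (\<exists>\<alpha>>0. m * t = \<alpha> * n + gcd n m)}"

lemma threshold_set:
  fixes n m :: nat
  assumes "2 \<le> m" "m < n"
  shows "finite {t. t \<le> n - 1 \<and> (\<exists>\<alpha>>0. m * t = \<alpha> * n + gcd n m)}"
    and "{t. t \<le> n - 1 \<and> (\<exists>\<alpha>>0. m * t = \<alpha> * n + gcd n m)} \<noteq> {}"
proof -
  show "finite {t. t \<le> n - 1 \<and> (\<exists>\<alpha>>0. m * t = \<alpha> * n + gcd n m)}"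
    by (rule finite_subset[of _ "{..n - 1}"]) auto
  have "\<exists>t \<alpha>. t \<le> n - 1 \<and> 0 < \<alpha> \<and> m * t = \<alpha> * n + gcd n m"
  proof (cases "m dvd n")
    case True
    then obtain r where r: "n = m * r" by blast
    with assms have "2 \<le> r" by (cases r; cases "r - 1") auto
    have "2 * r \<le> n" using assms r by simp
    with \<open>2 \<le> r\<close> have "r + 1 \<le> n - 1" by simp
    moreover have "m * (r + 1) = 1 * n + gcd n m"
      using True r by (simp add: gcd_nat.absorb2)
    ultimately show ?thesis by (intro exI[of _ "r + 1"] exI[of _ 1]) simp
  next
    case False
    have "gcd n m < m" using assms False
      by (metis gcd_dvd1 gcd_dvd2 dvd_imp_le le_neq_implies_less less_le_trans pos2)
    obtain x y where xy: "m * x = n * y + gcd m n"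
      using bezout_nat[of m n] assms by auto
    define t where "t = x mod n"
    have "(m * t) mod n = gcd n m mod n"
      unfolding t_def using xy by (simp add: mod_mult_right_eq gcd.commute)
    then have mod: "(m * t) mod n = gcd n m"
      using \<open>gcd n m < m\<close> assms by simp
    have "0 < gcd n m" using assms by simp
    then have "0 < t" using mod by (cases t) auto
    then have "gcd n m < m * t" using \<open>gcd n m < m\<close> by (cases t) auto
    then have "0 < m * t div n" using mod by (metis div_mult_mod_eq gr0I add_0 mult_0 nat_neq_iff)
    moreover have "m * t = (m * t div n) * n + gcd n m"
      using mod by (metis div_mult_mod_eq)
    moreover have "t \<le> n - 1" unfolding t_def using assms
      by (metis Suc_pred' less_Suc_eq_le mod_less_divisor not_less_zero gr0I)
    ultimately show ?thesis by blast
  qed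
  then show "{t. t \<le> n - 1 \<and> (\<exists>\<alpha>>0. m * t = \<alpha> * n + gcd n m)} \<noteq> {}" by blast
qed

end

theory Submission
  imports Defs
begin

text \<open>
  For \<open>t \<ge> t\<^sub>0\<close> there is a monomial \<open>x\<^sup>W\<close> with \<open>(J\<^sup>t : x\<^sup>W) = U\<close>, where \<open>U\<close> is the maximal ideal if
  \<open>d = 1\<close>. With \<open>m t\<^sub>0 = \<alpha> n + d\<close> it is the product of $(x_1 \cdots x_n)^\alpha$ and
  $(x_1 \cdots x_m)^{t - t_0}$: counting degrees in a residue class modulo \<open>d\<close> gives \<open>\<subseteq>\<close>, and a closed
  walk around the cycle that meets given representatives of the classes one after the other, in
  stretches whose lengths are multiples of \<open>m\<close>, gives \<open>\<supseteq>\<close>.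

  Stanley decompositions of \<open>S/I\<close> are partitions of the monomials outside \<open>I\<close> into translated
  orthants, and intersecting with \<open>x\<^sup>W S\<close> turns a partition for \<open>J\<^sup>t\<close> into one for \<open>U\<close>. For the depth,
  the Koszul complex of \<open>S/J\<^sup>t\<close> in degree \<open>W + (1, \<dots>, 1)\<close> is the cochain complex of the simplicial
  complex of the sets of variables that miss a class, which is a sphere of dimension \<open>d - 2\<close> up to
  homotopy; the resulting nonzero Koszul cohomology in degree \<open>d - 1\<close> bounds the length of regular
  sequences.
\<close>

text \<open>A generator of \<open>J\<close> has degree \<open>m/d\<close> in every residue class, so
  a monomial of \<open>J^t\<close> has degree at least \<open>t m/d\<close> in each. By
  \<open>m t0 = \<alpha> n + d\<close>, the monomial \<open>x^W\<close> has degree exactly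
  \<open>t m/d - 1\<close> in each class: one variable per class is missing. A squarefree
  transversal supplies just these, so the product has the least degree possible and must factor into
  \<open>t\<close> generators with nothing left over. Hence the walk has to be cut into blocks of
  length \<open>m\<close> without gaps.

  The walk fixes its own number \<open>T\<close> of blocks, with \<open>m T = X + d\<close> and
  \<open>X\<close> a multiple of \<open>n\<close>. Since \<open>T\<close> is less than
  \<open>n\<close>, the maximality of \<open>t0\<close> yields \<open>T \<le> t0\<close>, whichever
  transversal is given; what remains of \<open>(x_1 ... x_n)^\<alpha>\<close> then has a length
  divisible by \<open>m\<close> and is filled with whole blocks.

  For the depth, the class lives on the monomials \<open>x^W x_j1 ... x_ji\<close>. Membership of
  such a monomial in \<open>J^t\<close> depends only on the classes of the \<open>j\<close>, so
  cochains can be pulled back from the simplex on the \<open>d\<close> classes, and tested again on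
  the representatives \<open>1, ..., d\<close>.\<close>

abbreviation "keys \<equiv> Poly_Mapping.keys"
abbreviation "lookup \<equiv> Poly_Mapping.lookup"
abbreviation "single \<equiv> Poly_Mapping.single"

section \<open>Monomial ideals\<close>

definition exps :: "nat set \<Rightarrow> (nat \<Rightarrow>\<^sub>0 nat) set"
  where "exps Z = {b. keys b \<subseteq> Z}"

definition monom :: "(nat \<Rightarrow>\<^sub>0 nat) \<Rightarrow> 'k::field mpoly"
  where "monom b = single b 1"

definition mono_span :: "(nat \<Rightarrow>\<^sub>0 nat) set \<Rightarrow> 'k::field mpoly set"
  where "mono_span A = {p. keys p \<subseteq> A}"

text \<open>These are the exponent sets of monomial ideals. All ideals below are brought to the form
  \<open>mono_span A\<close>, where membership is a condition on the support of a
  polynomial.\<close>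

definition up_closed :: "nat \<Rightarrow> (nat \<Rightarrow>\<^sub>0 nat) set \<Rightarrow> bool"
  where "up_closed n A \<longleftrightarrow> A \<subseteq> exps {1..n} \<and> (\<forall>a\<in>A. \<forall>c\<in>exps {1..n}. a + c \<in> A)"

lemma lookup_single_mult_add:
  fixes p :: "'k::field mpoly"
  shows "lookup (single b c * p) (b + e) = c * lookup p e"
  by (simp add: lookup_mult lookup_single when_mult)

lemma sum_singles: "(\<Sum>b\<in>keys p. single b (lookup p b)) = p"
proof (rule poly_mapping_eqI)
  fix k
  have "lookup (\<Sum>b\<in>keys p. single b (lookup p b)) k = (\<Sum>b\<in>keys p. if b = k then lookup p b else 0)"
    by (simp add: lookup_sum lookup_single when_def)
  then show "lookup (\<Sum>b\<in>keys p. single b (lookup p b)) k = lookup p k"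
    by (simp add: in_keys_iff)
qed

lemma exps_add: "a \<in> exps Z \<Longrightarrow> b \<in> exps Z \<Longrightarrow> a + b \<in> exps Z"
  using Poly_Mapping.keys_add[of a b] by (auto simp: exps_def)

lemma exps_add_iff: "a + b \<in> exps Z \<longleftrightarrow> a \<in> exps Z \<and> b \<in> exps Z"
  by (auto simp: exps_def in_keys_iff lookup_add subset_iff)

lemma exps_zero [simp]: "0 \<in> exps Z"
  by (simp add: exps_def)

lemma exps_sum: "(\<And>i. i \<in> I \<Longrightarrow> f i \<in> exps Z) \<Longrightarrow> sum f I \<in> exps Z"
  by (induction I rule: infinite_finite_induct) (auto intro: exps_add)

lemma exps_single: "i \<in> Z \<Longrightarrow> single i k \<in> exps Z"
  by (auto simp: exps_def)

lemma mpolys_eq: "mpolys Z = mono_span (exps Z)"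
  by (auto simp: mpolys_def mono_span_def exps_def)

lemma carrier_mpoly_ring: "carrier (mpoly_ring n) = mono_span (exps {1..n})"
  by (simp add: mpoly_ring_def mpolys_eq)

lemma mpoly_ring_simps:
  "monoid.mult (mpoly_ring n) = (*)" "one (mpoly_ring n) = 1"
  "zero (mpoly_ring n) = 0" "add (mpoly_ring n) = (+)"
  by (simp_all add: mpoly_ring_def)

lemma mono_span_add: "p \<in> mono_span A \<Longrightarrow> q \<in> mono_span A \<Longrightarrow> p + q \<in> mono_span A"
  using Poly_Mapping.keys_add[of p q] by (auto simp: mono_span_def)

lemma mono_span_uminus: "p \<in> mono_span A \<Longrightarrow> - p \<in> mono_span A"
  by (auto simp: mono_span_def in_keys_iff)

lemma mono_span_diff: "p \<in> mono_span A \<Longrightarrow> q \<in> mono_span A \<Longrightarrow> p - q \<in> mono_span A"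
  using mono_span_add[of p A "- q"] mono_span_uminus[of q A] by simp

lemma mono_span_zero [simp]: "0 \<in> mono_span A"
  by (simp add: mono_span_def)

lemma mono_span_sum: "(\<And>i. i \<in> I \<Longrightarrow> f i \<in> mono_span A) \<Longrightarrow> sum f I \<in> mono_span A"
  by (induction I rule: infinite_finite_induct) (auto intro: mono_span_add)

lemma mono_span_single: "b \<in> A \<Longrightarrow> single b k \<in> mono_span A"
  by (simp add: mono_span_def)

lemma mono_span_monom_iff: "monom b \<in> mono_span A \<longleftrightarrow> b \<in> A"
  by (simp add: mono_span_def monom_def)

lemma mono_span_mult:
  assumes "p \<in> mono_span A" "q \<in> mono_span B" "\<And>a b. a \<in> A \<Longrightarrow> b \<in> B \<Longrightarrow> a + b \<in> C"
  shows "p * q \<in> mono_span C"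
  using assms keys_mult[of p q] unfolding mono_span_def by blast

lemma mono_span_mono: "A \<subseteq> B \<Longrightarrow> mono_span A \<subseteq> mono_span B"
  by (auto simp: mono_span_def)

lemma mono_span_iff: "p \<in> mono_span A \<longleftrightarrow> (\<forall>b. b \<notin> A \<longrightarrow> lookup p b = 0)"
  by (auto simp: mono_span_def in_keys_iff)

lemma monom_add: "monom (a + b) = monom a * monom b"
  by (simp add: monom_def mult_single)

lemma monom_zero [simp]: "monom 0 = 1"
  by (simp add: monom_def)

lemma monom_sum: "monom (sum f I) = (\<Prod>i\<in>I. monom (f i))"
  by (induction I rule: infinite_finite_induct) (auto simp: monom_add)

lemma mvar_eq_monom: "mvar i = monom (single i 1)"
  by (simp add: mvar_def monom_def)

lemma a_inv_mpoly_ring: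
  assumes "p \<in> carrier (mpoly_ring n)"
  shows "\<ominus>\<^bsub>mpoly_ring n\<^esub> p = - p"
proof -
  interpret cring "mpoly_ring n" by (rule cring_mpoly_ring)
  show ?thesis
    using assms by (intro minus_equality) (auto simp: mpoly_ring_simps carrier_mpoly_ring intro: mono_span_uminus)
qed

lemma a_minus_mpoly_ring:
  assumes "p \<in> carrier (mpoly_ring n)" "q \<in> carrier (mpoly_ring n)"
  shows "p \<ominus>\<^bsub>mpoly_ring n\<^esub> q = p - q"
  by (simp add: a_minus_def a_inv_mpoly_ring assms mpoly_ring_simps)

lemma ideal_mono_span:
  assumes "up_closed n A"
  shows "ideal (mono_span A) (mpoly_ring n)"
proof -
  interpret cring "mpoly_ring n" by (rule cring_mpoly_ring)
  have sub: "mono_span A \<subseteq> carrier (mpoly_ring n)"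
    using assms by (simp add: carrier_mpoly_ring mono_span_mono up_closed_def)
  have mult: "p * q \<in> mono_span A" if "p \<in> mono_span A" "q \<in> carrier (mpoly_ring n)" for p q
    using that assms by (auto simp: carrier_mpoly_ring up_closed_def intro: mono_span_mult)
  show ?thesis
  proof (rule idealI[OF local.ring_axioms])
    show "subgroup (mono_span A) (add_monoid (mpoly_ring n))"
    proof (rule subgroup.intro)
      fix x assume x: "x \<in> mono_span A"
      then show "inv\<^bsub>add_monoid (mpoly_ring n)\<^esub> x \<in> mono_span A"
        using a_inv_mpoly_ring[of x n] sub mono_span_uminus[OF x] by (auto simp: a_inv_def)
    qed (use sub in \<open>auto simp: mpoly_ring_simps intro: mono_span_add\<close>)
  qed (use mult in \<open>auto simp: mpoly_ring_simps mult.commute\<close>)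
qed

lemma ideal_sum_closed:
  assumes "ideal I (mpoly_ring n)" "\<And>i. i \<in> X \<Longrightarrow> f i \<in> I"
  shows "sum f X \<in> I"
proof -
  interpret ideal I "mpoly_ring n" by fact
  have "0 \<in> I" "\<And>p q. p \<in> I \<Longrightarrow> q \<in> I \<Longrightarrow> p + q \<in> I"
    using additive_subgroup.zero_closed[OF is_additive_subgroup]
      additive_subgroup.a_closed[OF is_additive_subgroup] by (simp_all add: mpoly_ring_simps)
  then show ?thesis using assms(2)
    by (induction X rule: infinite_finite_induct) auto
qed

lemma mono_span_subset_ideal:
  assumes I: "ideal I (mpoly_ring n)" and A: "A \<subseteq> exps {1..n}"
    and mon: "\<And>a. a \<in> A \<Longrightarrow> monom a \<in> I"
  shows "mono_span A \<subseteq> I"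
proof
  interpret ideal I "mpoly_ring n" by fact
  fix p :: "'a mpoly" assume p: "p \<in> mono_span A"
  have "single b (lookup p b) \<in> I" if "b \<in> keys p" for b
  proof -
    \<comment> \<open>The coefficient acts as a constant polynomial, since ideals are closed only
      under multiplication by ring elements.\<close>
    have "single 0 (lookup p b) * monom b \<in> I"
      using I_l_closed[OF mon, of b "single 0 (lookup p b)"] that p
      by (auto simp: mpoly_ring_simps carrier_mpoly_ring mono_span_def exps_def)
    then show ?thesis by (simp add: monom_def mult_single)
  qed
  then have "(\<Sum>b\<in>keys p. single b (lookup p b)) \<in> I"
    by (intro ideal_sum_closed[OF I]) auto
  then show "p \<in> I" by (simp add: sum_singles)
qed

lemma genideal_monomials:
  assumes B: "B \<subseteq> exps {1..n}"
  shows "Idl\<^bsub>mpoly_ring n\<^esub> (monom ` B) = mono_span {b + c |b c. b \<in> B \<and> c \<in> exps {1..n}}"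
    (is "_ = mono_span ?A")
proof
  interpret cring "mpoly_ring n" by (rule cring_mpoly_ring)
  have carr: "monom ` B \<subseteq> carrier (mpoly_ring n)"
    using B by (auto simp: carrier_mpoly_ring mono_span_monom_iff)
  interpret I: ideal "Idl\<^bsub>mpoly_ring n\<^esub> (monom ` B)" "mpoly_ring n"
    using carr by (rule genideal_ideal)
  have up: "up_closed n ?A"
    using B unfolding up_closed_def
    by (auto simp: add.assoc intro!: exps_add) (metis add.assoc exps_add)
  have "monom ` B \<subseteq> mono_span ?A"
    using exps_zero[of "{1..n}"] by (force simp: mono_span_monom_iff)
  then show "Idl\<^bsub>mpoly_ring n\<^esub> (monom ` B) \<subseteq> mono_span ?A"
    by (rule genideal_minimal[OF ideal_mono_span[OF up]])
  show "mono_span ?A \<subseteq> Idl\<^bsub>mpoly_ring n\<^esub> (monom ` B)"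
  proof (rule mono_span_subset_ideal[OF I.is_ideal])
    show "?A \<subseteq> exps {1..n}" using up by (simp add: up_closed_def)
    fix a assume "a \<in> ?A"
    then obtain b c where bc: "a = b + c" "b \<in> B" "c \<in> exps {1..n}" by auto
    then have "monom b \<in> Idl\<^bsub>mpoly_ring n\<^esub> (monom ` B)"
      using genideal_self[OF carr] by auto
    then show "monom a \<in> Idl\<^bsub>mpoly_ring n\<^esub> (monom ` B)"
      using I.I_r_closed[of "monom b" "monom c"] bc
      by (simp add: monom_add mpoly_ring_simps carrier_mpoly_ring mono_span_monom_iff)
  qed
qed

lemma ideal_prod_mono_span:
  assumes A: "up_closed n A" and B: "up_closed n B"
  shows "ideal_prod (mpoly_ring n) (mono_span A) (mono_span B) = mono_span {a + b |a b. a \<in> A \<and> b \<in> B}"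
    (is "?P = mono_span ?C")
proof
  interpret cring "mpoly_ring n" by (rule cring_mpoly_ring)
  show "?P \<subseteq> mono_span ?C"
  proof
    fix x assume "x \<in> ?P"
    then show "x \<in> mono_span ?C"
    proof (induction x rule: ideal_prod.induct)
      case (prod i j)
      have "i * j \<in> mono_span ?C"
        by (rule mono_span_mult[OF prod]) auto
      then show ?case by (simp add: mpoly_ring_simps)
    qed (auto simp: mpoly_ring_simps intro: mono_span_add)
  qed
  show "mono_span ?C \<subseteq> ?P"
  proof (rule mono_span_subset_ideal[OF ideal_prod_is_ideal[OF ideal_mono_span[OF A] ideal_mono_span[OF B]]])
    show "?C \<subseteq> exps {1..n}" using A B by (auto simp: up_closed_def intro: exps_add)
    fix c assume "c \<in> ?C"
    then obtain a b where "c = a + b" "a \<in> A" "b \<in> B" by auto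
    then show "monom c \<in> ?P"
      using ideal_prod.prod[of "monom a" "mono_span A" "monom b" "mono_span B" "mpoly_ring n"]
      by (simp add: mono_span_monom_iff monom_add mpoly_ring_simps)
  qed
qed

text \<open>The zeroth power is the unit ideal, in agreement with \<open>ideals_set\<close>. Taking
  all exponents there lets surplus variables be absorbed as a zeroth power.\<close>

fun exps_power :: "nat \<Rightarrow> (nat \<Rightarrow>\<^sub>0 nat) set \<Rightarrow> nat \<Rightarrow> (nat \<Rightarrow>\<^sub>0 nat) set" where
  "exps_power n A 0 = exps {1..n}"
| "exps_power n A (Suc t) = {a + b |a b. a \<in> exps_power n A t \<and> b \<in> A}"

lemma up_closed_exps_power:
  assumes "up_closed n A"
  shows "up_closed n (exps_power n A t)"
proof (induction t)
  case (Suc t)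
  then show ?case
    using assms unfolding up_closed_def
    by (auto simp: add.assoc intro!: exps_add) (metis add.assoc)
qed (auto simp: up_closed_def intro: exps_add)

lemma ideal_power_mono_span:
  assumes "up_closed n A"
  shows "ideal_power (mpoly_ring n) (mono_span A) t = mono_span (exps_power n A t)"
proof -
  have sel: "monoid.mult (ideals_set (mpoly_ring n)) = ideal_prod (mpoly_ring n)"
    "one (ideals_set (mpoly_ring n)) = carrier (mpoly_ring n)"
    by (simp_all add: ideals_set_def)
  show ?thesis
    using assms up_closed_exps_power[OF assms]
    by (induction t)
      (simp_all add: ideal_power_def nat_pow_def sel carrier_mpoly_ring ideal_prod_mono_span)
qed

lemma exps_power_add:
  assumes A: "up_closed n A" and "a \<in> exps_power n A s" "b \<in> exps_power n A t"
  shows "a + b \<in> exps_power n A (s + t)"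
  using assms(3)
proof (induction t arbitrary: b)
  case 0
  then show ?case
    using up_closed_exps_power[OF A, of s] assms(2) by (auto simp: up_closed_def)
next
  case (Suc t)
  then obtain c e where "b = c + e" "c \<in> exps_power n A t" "e \<in> A" by auto
  then show ?case using Suc.IH[of c] by (auto simp: add.assoc[symmetric])
qed

section \<open>Exponents of the path ideal\<close>

text \<open>Positions on the cycle are counted from 0 and are not reduced, so a walk winding around
  several times is described by ordinary natural numbers; only the variable is read modulo
  \<open>n\<close>.\<close>

definition cyc :: "nat \<Rightarrow> nat \<Rightarrow> nat \<Rightarrow>\<^sub>0 nat"
  where "cyc n a = single (a mod n + 1) 1"

definition arc :: "nat \<Rightarrow> nat \<Rightarrow> nat \<Rightarrow> nat \<Rightarrow>\<^sub>0 nat"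
  where "arc n a l = (\<Sum>k<l. cyc n (a + k))"

definition path_exps :: "nat \<Rightarrow> nat \<Rightarrow> (nat \<Rightarrow>\<^sub>0 nat) set"
  where "path_exps n m = {arc n a m + c |a c. c \<in> exps {1..n}}"

definition transversal :: "nat \<Rightarrow> nat \<Rightarrow> (nat \<Rightarrow>\<^sub>0 nat) set"
  where "transversal n d = {b \<in> exps {1..n}. \<forall>c<d. \<exists>i\<in>keys b. (i - 1) mod d = c}"

lemma cyc_exps: "0 < n \<Longrightarrow> cyc n a \<in> exps {1..n}"
  unfolding cyc_def by (rule exps_single) (simp add: Suc_leI)

lemma arc_exps: "0 < n \<Longrightarrow> arc n a l \<in> exps {1..n}"
  unfolding arc_def by (intro exps_sum cyc_exps)

lemma arc_0 [simp]: "arc n a 0 = 0"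
  by (simp add: arc_def)

lemma arc_Suc: "arc n a (Suc l) = arc n a l + cyc n (a + l)"
  by (simp add: arc_def)

lemma arc_1 [simp]: "arc n a (Suc 0) = cyc n a"
  by (simp add: arc_def)

lemma arc_add: "arc n a (k + l) = arc n a k + arc n (a + k) l"
  by (induction l) (simp_all add: arc_Suc add.assoc)

lemma cyc_cong: "a mod n = b mod n \<Longrightarrow> cyc n a = cyc n b"
  by (simp add: cyc_def)

lemma arc_cong: "a mod n = b mod n \<Longrightarrow> arc n a l = arc n b l"
  unfolding arc_def by (intro sum.cong refl cyc_cong mod_add_cong)

text \<open>Both sides are the arc of length \<open>l + 1\<close> from \<open>a\<close>, split off
  at its two ends.\<close>

lemma arc_rotate: "cyc n a + arc n (Suc a) l = arc n a l + cyc n (a + l)"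
  using arc_add[of n a 1 l] by (simp add: arc_Suc)

text \<open>A closed walk may be started anywhere: when the start moves by one, the vertex lost in
  front reappears at the end.\<close>

lemma arc_closed:
  assumes "n dvd l"
  shows "arc n a l = arc n 0 l"
proof (induction a)
  case (Suc a)
  have "cyc n (a + l) = cyc n a"
    using assms by (intro cyc_cong) auto
  then have "cyc n a + arc n (Suc a) l = cyc n a + arc n a l"
    by (simp add: arc_rotate add.commute)
  with Suc show ?case by simp
qed simp

lemma up_closed_path_exps: "0 < n \<Longrightarrow> up_closed n (path_exps n m)"
  unfolding up_closed_def path_exps_def
proof (intro conjI subsetI ballI; elim CollectE exE conjE)
  fix b a c e assume "b = arc n a m + c" "c \<in> exps {1..n}" "e \<in> exps {1..n}"
  then have "b + e = arc n a m + (c + e) \<and> c + e \<in> exps {1..n}"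
    by (simp only: add.assoc exps_add)
  then show "b + e \<in> {arc n a m + c |a c. c \<in> exps {1..n}}" by blast
qed (simp only: arc_exps exps_add)

lemma cycle_path_ideal_eq:
  assumes "0 < n"
  shows "cycle_path_ideal n m = mono_span (path_exps n m)"
proof -
  let ?B = "(\<lambda>i. arc n (i - 1) m) ` {1..n}"
  have "(\<Prod>k<m. mvar ((i + k - 1) mod n + 1)) = monom (arc n (i - 1) m)" if "i \<in> {1..n}" for i
    using that by (simp add: arc_def monom_sum mvar_eq_monom cyc_def)
  then have gens: "(\<lambda>i. \<Prod>k<m. mvar ((i + k - 1) mod n + 1)) ` {1..n} = monom ` ?B"
    unfolding image_image by (rule image_cong[OF refl])
  have B: "?B \<subseteq> exps {1..n}" using arc_exps[OF assms] by blast
  have "{b + c |b c. b \<in> ?B \<and> c \<in> exps {1..n}} = path_exps n m"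
  proof -
    have "arc n a m \<in> ?B" for a
    proof (rule image_eqI)
      show "arc n a m = arc n (a mod n + 1 - 1) m" by (rule arc_cong) simp
      show "a mod n + 1 \<in> {1..n}" using assms by (simp add: Suc_leI)
    qed
    then show ?thesis unfolding path_exps_def by blast
  qed
  then show ?thesis
    unfolding cycle_path_ideal_def gens genideal_monomials[OF B] by (rule arg_cong)
qed

lemma single_add_diff:
  fixes e :: "nat \<Rightarrow>\<^sub>0 nat"
  assumes "i \<in> keys e"
  shows "single i 1 + (e - single i 1) = e"
proof (rule poly_mapping_eqI)
  fix k
  have "lookup e i \<noteq> 0" using assms by (simp add: in_keys_iff)
  then show "lookup (single i 1 + (e - single i 1)) k = lookup e k"
    by (auto simp: lookup_add lookup_minus lookup_single when_def)
qed

lemma residue_class_ideal_eq: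
  assumes "d dvd n" "0 < d"
  shows "residue_class_ideal n d = mono_span (transversal n d)"
proof -
  let ?A = "\<lambda>j. {b \<in> exps {1..n}. \<exists>i\<in>keys b. (i - 1) mod d = j - 1}"
  have "Idl\<^bsub>mpoly_ring n\<^esub> ((\<lambda>i. mvar (d * i + j)) ` {..<n div d}) = mono_span (?A j)"
    if j: "j \<in> {1..d}" for j
  proof -
    let ?B = "(\<lambda>i. single (d * i + j) 1) ` {..<n div d}"
    have le: "d * i + j \<le> n" if "i < n div d" for i
    proof -
      have "d * i + d \<le> d * (n div d)" using that by (metis Suc_leI mult_Suc_right mult_le_mono2 add.commute)
      with assms j show ?thesis by simp
    qed
    then have B: "?B \<subseteq> exps {1..n}" using j by (auto intro!: exps_single)
    have "{b + c |b c. b \<in> ?B \<and> c \<in> exps {1..n}} = ?A j"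
    proof (intro equalityI subsetI)
      fix e assume "e \<in> {b + c |b c. b \<in> ?B \<and> c \<in> exps {1..n}}"
      then obtain i c where "i < n div d" "c \<in> exps {1..n}" and e: "e = single (d * i + j) 1 + c"
        by auto
      moreover have "(d * i + j - 1) mod d = j - 1"
      proof -
        have "d * i + j - 1 = d * i + (j - 1)" using j by simp
        then show ?thesis using j by (simp only: mod_mult_self4) auto
      qed
      ultimately show "e \<in> ?A j"
        using B by (auto simp: in_keys_iff lookup_add lookup_single intro!: exps_add bexI[of _ "d * i + j"])
    next
      fix e assume e: "e \<in> ?A j"
      then obtain i where i: "i \<in> keys e" "(i - 1) mod d = j - 1" "i \<in> {1..n}"
        by (auto simp: exps_def)
      define q where "q = (i - 1) div d"
      have "i - 1 = d * q + (j - 1)"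
        unfolding q_def i(2)[symmetric] by simp
      then have iq: "i = d * q + j" using i(3) j by auto
      have "d * q < n" using iq i j by simp
      then have "q < n div d" using assms by (metis dvd_mult_div_cancel nat_mult_less_cancel_disj)
      moreover have eq: "e = single i 1 + (e - single i 1)"
        using i(1) by (rule single_add_diff[symmetric])
      moreover have "e - single i 1 \<in> exps {1..n}"
        using e exps_add_iff[of "single i 1" "e - single i 1" "{1..n}", folded eq] by blast
      ultimately show "e \<in> {b + c |b c. b \<in> ?B \<and> c \<in> exps {1..n}}"
        using iq by blast
    qed
    then show ?thesis
      using genideal_monomials[OF B] by (simp add: image_image mvar_eq_monom)
  qed
  then have "residue_class_ideal n d = (\<Inter>j\<in>{1..d}. mono_span (?A j))"
    unfolding residue_class_ideal_def by (rule INF_cong[OF refl])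
  also have "\<dots> = mono_span (\<Inter>j\<in>{1..d}. ?A j)"
    using assms by (auto simp: mono_span_def)
  also have "(\<Inter>j\<in>{1..d}. ?A j) = transversal n d"
  proof -
    have "(\<forall>j\<in>{1..d}. P (j - 1)) \<longleftrightarrow> (\<forall>c<d. P c)" for P :: "nat \<Rightarrow> bool"
    proof (intro iffI allI impI ballI)
      fix c assume "\<forall>j\<in>{1..d}. P (j - 1)" "c < d"
      from bspec[OF this(1), of "Suc c"] this(2) show "P c" by simp
    next
      fix j assume "\<forall>c<d. P c" "j \<in> {1..d}"
      from spec[OF this(1), of "j - 1"] this(2) show "P (j - 1)" by auto
    qed
    from this[of "\<lambda>c. \<exists>i\<in>keys b. (i - 1) mod d = c" for b]
    have "transversal n d = {b \<in> exps {1..n}. \<forall>j\<in>{1..d}. \<exists>i\<in>keys b. (i - 1) mod d = j - 1}"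
      unfolding transversal_def by blast
    \<comment> \<open>The intersection must range over a nonempty index set, as the condition
      \<open>b \<in> exps {1..n}\<close> comes only from its members.\<close>
    moreover have "1 \<in> {1..d}" using assms by simp
    ultimately show ?thesis by blast
  qed
  finally show ?thesis .
qed

lemma up_closed_transversal: "up_closed n (transversal n d)"
proof -
  have "keys a \<subseteq> keys (a + c)" for a c :: "nat \<Rightarrow>\<^sub>0 nat"
    by (auto simp: in_keys_iff lookup_add)
  then show ?thesis
    unfolding up_closed_def transversal_def using exps_add by fast
qed

section \<open>Degrees of monomials in a single residue class\<close>

definition class_degree :: "nat \<Rightarrow> nat \<Rightarrow> nat \<Rightarrow> (nat \<Rightarrow>\<^sub>0 nat) \<Rightarrow> nat"
  where "class_degree n d c b = (\<Sum>i\<in>{1..n}. if (i - 1) mod d = c then lookup b i else 0)"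

lemma class_degree_add: "class_degree n d c (a + b) = class_degree n d c a + class_degree n d c b"
  unfolding class_degree_def sum.distrib[symmetric] by (rule sum.cong[OF refl]) (simp add: lookup_add)

lemma class_degree_0 [simp]: "class_degree n d c 0 = 0"
  by (simp add: class_degree_def)

lemma class_degree_cyc:
  assumes "0 < n" "d dvd n"
  shows "class_degree n d c (cyc n a) = of_bool (a mod d = c)"
proof -
  have "class_degree n d c (cyc n a)
      = (\<Sum>i\<in>{1..n}. if i = a mod n + 1 then of_bool (a mod n mod d = c) else 0)"
    unfolding class_degree_def cyc_def by (intro sum.cong) (auto simp: lookup_single)
  then show ?thesis using assms by (simp add: mod_mod_cancel Suc_leI)
qed

text \<open>An arc of length \<open>d\<close> meets every class once. This is counted directly for
  the start \<open>0\<close>; moving the start from \<open>a\<close> to \<open>a + 1\<close>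
  exchanges \<open>a\<close> for \<open>a + d\<close>, which has the same class because
  \<open>d\<close> divides \<open>n\<close>.\<close>

lemma class_degree_arc:
  assumes n: "0 < n" "d dvd n" and d: "0 < d" and c: "c < d"
  shows "class_degree n d c (arc n a (d * q)) = q"
proof -
  have arcd: "class_degree n d c (arc n a d) = 1" for a
  proof (induction a)
    case 0
    have "class_degree n d c (arc n 0 l) = of_bool (c < l)" if "l \<le> d" for l
      using that n by (induction l) (auto simp: arc_Suc class_degree_add class_degree_cyc)
    then show ?case using c by simp
  next
    case (Suc a)
    have "class_degree n d c (cyc n a + arc n (Suc a) d)
        = class_degree n d c (arc n a d + cyc n (a + d))" by (simp only: arc_rotate)
    then show ?case using Suc n by (simp add: class_degree_add class_degree_cyc)
  qed
  then show ?thesis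
    by (induction q arbitrary: a) (simp_all add: arc_add class_degree_add)
qed

lemma class_degree_exps_power:
  assumes n: "0 < n" "d dvd n" and d: "0 < d" and c: "c < d"
    and b: "b \<in> exps_power n (path_exps n (d * q)) t"
  shows "t * q \<le> class_degree n d c b"
  using b
proof (induction t arbitrary: b)
  case (Suc t)
  then obtain e a f where "b = e + (arc n a (d * q) + f)" "e \<in> exps_power n (path_exps n (d * q)) t"
    by (auto simp: path_exps_def)
  with Suc.IH[of e] show ?case
    by (simp add: class_degree_add class_degree_arc[OF n d c])
qed simp

section \<open>Walks on the cycle made of blocks of length \<open>m\<close>\<close>

lemma arc_in_exps_power:
  assumes "0 < n"
  shows "arc n a (l * m) \<in> exps_power n (path_exps n m) l"
proof (induction l)
  case (Suc l)
  have "arc n a (Suc l * m) = arc n a (l * m) + arc n (a + l * m) m"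
    by (simp add: arc_add add.commute flip: arc_add)
  moreover have "arc n (a + l * m) m + 0 \<in> path_exps n m"
    unfolding path_exps_def using exps_zero by blast
  ultimately show ?case using Suc by auto
qed simp

text \<open>From \<open>p\<close>, some number of blocks ends exactly on the vertex
  \<open>q\<close>: the congruence \<open>l m = q + 1 - p\<close> modulo \<open>n\<close> is
  solvable because \<open>d\<close> divides the right-hand side, and its solutions form a class
  modulo \<open>n div d\<close>, which gives the upper bound on \<open>l\<close>.\<close>

lemma ex_step:
  fixes n m d p q :: nat
  assumes d: "d = gcd n m" "0 < n" "0 < m" and pq: "p mod d = (q + 1) mod d"
  shows "\<exists>l. 1 \<le> l \<and> l \<le> n div d \<and> (p + (l * m - 1)) mod n = q mod n"
proof -
  have "0 < d" using d by simp
  obtain r where r: "n = d * r" using d by (metis dvdE gcd_dvd1)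
  have "int d dvd int q + 1 - int p"
    using pq by (metis mod_eq_dvd_iff of_nat_1 of_nat_add of_nat_mod)
  then obtain k where k: "int q + 1 - int p = int d * k" by (rule dvdE)
  obtain u v where uv: "u * int m + v * int n = int d"
    using bezout_int[of "int m" "int n"] d by (auto simp: gcd.commute)
  \<comment> \<open>With the Bezout coefficient \<open>u\<close>, the product \<open>u * k\<close>
    solves the congruence. Its representative is taken in \<open>1..r\<close>, not in
    \<open>0..r - 1\<close>, because the stretch must be nonempty to have a last vertex.\<close>
  define l where "l = nat ((u * k - 1) mod int r + 1)"
  have "0 < r" using r d by (cases r) auto
  then have "0 \<le> (u * k - 1) mod int r" "(u * k - 1) mod int r < int r" by simp_all
  then have l: "1 \<le> l" "l \<le> r" "int l = (u * k - 1) mod int r + 1"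
    unfolding l_def by linarith+
  have "int r dvd int l - u * k"
  proof -
    have "int l - u * k = int r * - ((u * k - 1) div int r)"
      using l(3) minus_mod_eq_mult_div[of "u * k - 1" "int r"] by simp
    then show ?thesis by simp
  qed
  then have "int n dvd int m * (int l - u * k)"
    using r d by (metis gcd_dvd2 mult_dvd_mono of_nat_dvd_iff of_nat_mult)
  moreover have "int p + (int l * int m - 1) - int q = int m * (int l - u * k) - int n * (v * k)"
  proof -
    have "int q + 1 - int p = (u * int m + v * int n) * k" using k uv by simp
    then show ?thesis by (simp add: algebra_simps)
  qed
  moreover have "int (p + (l * m - 1)) = int p + (int l * int m - 1)"
  proof -
    have "1 \<le> l * m" using l d by (simp add: Suc_leI)
    then show ?thesis by (simp only: of_nat_add of_nat_diff of_nat_mult of_nat_1)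
  qed
  ultimately have "int n dvd int (p + (l * m - 1)) - int q"
    by (simp only: dvd_diff dvd_triv_left)
  then have "int (p + (l * m - 1)) mod int n = int q mod int n"
    by (simp only: mod_eq_dvd_iff)
  then have "(p + (l * m - 1)) mod n = q mod n"
    by (simp only: of_nat_mod[symmetric] of_nat_eq_iff)
  moreover have "n div d = r" using r \<open>0 < d\<close> by simp
  ultimately show ?thesis using l by blast
qed

text \<open>After \<open>s\<close> stretches the walk stands at \<open>p\<close>, with
  \<open>T\<close> blocks used. Each stretch ends on a prescribed vertex, and the next stretch
  starts on this vertex again, so each contributes one repeated vertex: \<open>T m\<close> is the
  length \<open>p - q 0\<close> of the arc plus \<open>s\<close>. A stretch therefore advances by
  \<open>-1\<close> modulo \<open>d\<close>, which is why the classes are met in the order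
  \<open>d - 1, ..., 0\<close>. For \<open>s = d\<close> the walk is closed.\<close>

lemma walk:
  fixes n m d :: nat and q :: "nat \<Rightarrow> nat"
  assumes d: "d = gcd n m" "0 < n" "0 < m" and q: "\<And>c. c < d \<Longrightarrow> q c mod d = c" and "s \<le> d"
  shows "\<exists>T p. q 0 \<le> p \<and> p + s = q 0 + T * m \<and> T \<le> s * (n div d) \<and>
    (0 < s \<longrightarrow> p mod n = q (d - s) mod n) \<and>
    arc n (q 0) (p - q 0) + (\<Sum>k\<in>{d - s..<d}. cyc n (q k)) \<in> exps_power n (path_exps n m) T"
  using \<open>s \<le> d\<close>
proof (induction s)
  case 0
  show ?case by (rule exI[of _ 0], rule exI[of _ "q 0"]) simp
next
  case (Suc s)
  then obtain T p where p: "q 0 \<le> p" "p + s = q 0 + T * m" and T: "T \<le> s * (n div d)"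
    and A: "arc n (q 0) (p - q 0) + (\<Sum>k\<in>{d - s..<d}. cyc n (q k)) \<in> exps_power n (path_exps n m) T"
    by auto
  define q' where "q' = q (d - Suc s)"
  have "d dvd p + s"
  proof -
    have "0 < d" "d dvd m" using d by simp_all
    then have "d dvd q 0" using q[of 0] by (simp add: mod_eq_0_iff_dvd)
    then show ?thesis unfolding p(2) using \<open>d dvd m\<close> by (simp only: dvd_add dvd_mult)
  qed
  moreover have "d dvd q' + 1 + s"
  proof -
    have "q' mod d = d - Suc s" unfolding q'_def using Suc.prems by (intro q) simp
    moreover have "q' = d * (q' div d) + q' mod d" by simp
    ultimately have "q' + 1 + s = d * (q' div d) + d" using Suc.prems by linarith
    then show ?thesis by simp
  qed
  ultimately have "int d dvd int (p + s) - int (q' + 1 + s)"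
    by (intro dvd_diff) (simp_all only: of_nat_dvd_iff)
  then have "int d dvd int p - int (q' + 1)"
    by (simp add: algebra_simps)
  then have "p mod d = (q' + 1) mod d"
    by (simp only: mod_eq_dvd_iff[symmetric] of_nat_mod[symmetric] of_nat_eq_iff)
  then obtain l where l: "1 \<le> l" "l \<le> n div d" "(p + (l * m - 1)) mod n = q' mod n"
    using ex_step[OF d] by blast
  \<comment> \<open>The stretch covers the positions \<open>p, ..., p'\<close> and the next one
    begins at \<open>p'\<close>; the vertex \<open>q'\<close> there is the one counted
    twice.\<close>
  define p' where "p' = p + (l * m - 1)"
  have lm: "1 \<le> l * m" using l d by (simp add: Suc_leI)
  have 1: "arc n (q 0) (p' - q 0) = arc n (q 0) (p - q 0) + arc n p (l * m - 1)"
    using p(1) arc_add[of n "q 0" "p - q 0" "l * m - 1"] by (simp add: p'_def)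
  have "{d - Suc s..<d} = insert (d - Suc s) {d - s..<d}"
    using Suc.prems by auto
  then have 2: "(\<Sum>k\<in>{d - Suc s..<d}. cyc n (q k)) = cyc n q' + (\<Sum>k\<in>{d - s..<d}. cyc n (q k))"
    using Suc.prems by (simp add: q'_def)
  have 3: "arc n p (l * m) = arc n p (l * m - 1) + cyc n q'"
    using lm cyc_cong[OF l(3)] arc_Suc[of n p "l * m - 1"] by simp
  have "arc n (q 0) (p' - q 0) + (\<Sum>k\<in>{d - Suc s..<d}. cyc n (q k))
      = (arc n (q 0) (p - q 0) + (\<Sum>k\<in>{d - s..<d}. cyc n (q k))) + arc n p (l * m)"
    unfolding 1 2 3 by (simp only: add_ac)
  also have "\<dots> \<in> exps_power n (path_exps n m) (T + l)"
    by (rule exps_power_add[OF up_closed_path_exps[OF d(2)] A arc_in_exps_power[OF d(2)]])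
  finally have 4: "arc n (q 0) (p' - q 0) + (\<Sum>k\<in>{d - Suc s..<d}. cyc n (q k))
      \<in> exps_power n (path_exps n m) (T + l)" .
  have 5: "p' + Suc s = q 0 + (T + l) * m"
    using p(2) lm unfolding p'_def add_mult_distrib by linarith
  have 6: "p' mod n = q (d - Suc s) mod n"
    using l(3) unfolding p'_def q'_def .
  have 7: "q 0 \<le> p'" "T + l \<le> Suc s * (n div d)"
    using p T l by (simp_all add: p'_def)
  show ?case
    by (rule exI[of _ "T + l"], rule exI[of _ p']) (simp only: 4 5 6 7 simp_thms)
qed

text \<open>One variable of \<open>b\<close> is chosen per class. Variables from different classes
  are distinct, so their product divides \<open>b\<close>.\<close>

lemma transversal_decompose:
  assumes n: "0 < n" and b: "b \<in> transversal n d"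
  obtains q e where "\<And>c. c < d \<Longrightarrow> q c mod d = c" "e \<in> exps {1..n}" "b = (\<Sum>k<d. cyc n (q k)) + e"
proof -
  have "\<forall>c<d. \<exists>i. i \<in> keys b \<and> (i - 1) mod d = c" "keys b \<subseteq> {1..n}"
    using b by (auto simp: transversal_def exps_def)
  then obtain f where f: "\<And>c. c < d \<Longrightarrow> f c \<in> keys b \<and> (f c - 1) mod d = c \<and> f c \<in> {1..n}"
    by (metis subsetD)
  define e where "e = b - (\<Sum>k<d. cyc n (f k - 1))"
  have cyc: "cyc n (f k - 1) = single (f k) 1" if "k < d" for k
    using f[OF that] n by (auto simp: cyc_def)
  have "b = (\<Sum>k<d. cyc n (f k - 1)) + e"
  proof (rule poly_mapping_eqI)
    fix i
    have "lookup (\<Sum>k<d. cyc n (f k - 1)) i = (\<Sum>k<d. lookup (cyc n (f k - 1)) i)"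
      by (simp add: lookup_sum)
    \<comment> \<open>Only the class of \<open>i\<close> can contribute at \<open>i\<close>. The
      bound by \<open>lookup b i\<close> makes the truncated subtraction in \<open>e\<close>
      exact.\<close>
    also have "\<dots> \<le> (\<Sum>k<d. if k = (i - 1) mod d then lookup b i else 0)"
    proof (rule sum_mono)
      fix k assume "k \<in> {..<d}"
      then show "lookup (cyc n (f k - 1)) i \<le> (if k = (i - 1) mod d then lookup b i else 0)"
        using f[of k] cyc[of k] by (auto simp: lookup_single when_def in_keys_iff)
    qed
    also have "\<dots> \<le> lookup b i" by simp
    finally show "lookup b i = lookup ((\<Sum>k<d. cyc n (f k - 1)) + e) i"
      by (simp add: e_def lookup_add lookup_minus)
  qed
  moreover from this have "e \<in> exps {1..n}"
    using b exps_add_iff[of "\<Sum>k<d. cyc n (f k - 1)" e "{1..n}"] by (simp add: transversal_def)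
  ultimately show ?thesis using that[of "\<lambda>k. f k - 1" e] f by blast
qed

section \<open>The threshold and the colon of a power of the path ideal\<close>

lemma threshold_spec:
  assumes "2 \<le> m" "m < n"
  obtains \<alpha> where "0 < \<alpha>" "m * threshold n m = \<alpha> * n + gcd n m"
proof -
  have "threshold n m \<in> {t. t \<le> n - 1 \<and> (\<exists>\<alpha>>0. m * t = \<alpha> * n + gcd n m)}"
    unfolding threshold_def by (rule Max_in) (use threshold_set[OF assms] in blast)+
  then show ?thesis using that by blast
qed

lemma le_threshold:
  assumes "2 \<le> m" "m < n" "t \<le> n - 1" "0 < \<alpha>" "m * t = \<alpha> * n + gcd n m"
  shows "t \<le> threshold n m"
  unfolding threshold_def
  by (rule Max_ge[OF threshold_set(1)[OF assms(1,2)]], intro CollectI conjI exI[of _ \<alpha>]) fact+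

lemma path_exps_power_colon:
  assumes mn: "2 \<le> m" "m < n" and t: "threshold n m \<le> t"
  obtains W where "W \<in> exps {1..n}"
    "\<And>b. b \<in> exps {1..n} \<Longrightarrow>
      W + b \<in> exps_power n (path_exps n m) t \<longleftrightarrow> b \<in> transversal n (gcd n m)"
proof -
  define d where "d = gcd n m"
  define t0 where "t0 = threshold n m"
  have n: "0 < n" and m: "0 < m" and d: "0 < d" "d dvd n" "d dvd m" using mn by (auto simp: d_def)
  note up = up_closed_path_exps[OF n, of m]
  obtain \<alpha> where \<alpha>: "0 < \<alpha>" "m * t0 = \<alpha> * n + d"
    using threshold_spec[OF mn] by (auto simp: t0_def d_def)
  define W where "W = arc n 0 (\<alpha> * n) + arc n 0 ((t - t0) * m)"
  have "b \<in> transversal n d" if b: "b \<in> exps {1..n}" and Wb: "W + b \<in> exps_power n (path_exps n m) t" for b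
  proof -
    obtain r q where r: "n = d * r" and q: "m = d * q" using d by (meson dvdE)
    have "\<exists>i\<in>keys b. (i - 1) mod d = c" if c: "c < d" for c
    proof -
      have "t * q \<le> class_degree n d c (W + b)"
        using class_degree_exps_power[OF n d(2,1) c, of _ q] Wb q by simp
      also have "\<dots> = \<alpha> * r + (t - t0) * q + class_degree n d c b"
        using class_degree_arc[OF n d(2,1) c, of 0 "\<alpha> * r"]
          class_degree_arc[OF n d(2,1) c, of 0 "(t - t0) * q"]
        by (simp add: W_def class_degree_add r q mult_ac)
      finally have "t * q \<le> \<alpha> * r + (t - t0) * q + class_degree n d c b" .
      moreover have "q * t0 = \<alpha> * r + 1"
      proof -
        have "d * (q * t0) = d * (\<alpha> * r + 1)" using \<alpha>(2) r q by (simp add: algebra_simps)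
        with d(1) show ?thesis by (simp only: mult_cancel1) blast
      qed
      moreover have "t * q = q * t0 + (t - t0) * q"
      proof -
        obtain s where "t = t0 + s" using t by (auto simp: t0_def le_iff_add)
        then show ?thesis by (simp add: algebra_simps)
      qed
      \<comment> \<open>\<open>W\<close> has degree \<open>t * q - 1\<close> in the class
        \<open>c\<close>, one short of what is required.\<close>
      ultimately have "class_degree n d c b \<noteq> 0" by linarith
      then obtain i where "(i - 1) mod d = c" "lookup b i \<noteq> 0"
        unfolding class_degree_def
        by (rule sum.not_neutral_contains_not_neutral) (simp split: if_splits)
      then show ?thesis by (auto simp: in_keys_iff)
    qed
    then show ?thesis using b by (simp add: transversal_def)
  qed
  moreover have "W + b \<in> exps_power n (path_exps n m) t" if b: "b \<in> transversal n d" for b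
  proof -
    obtain q e where q: "\<And>c. c < d \<Longrightarrow> q c mod d = c" and e: "e \<in> exps {1..n}"
      and be: "b = (\<Sum>k<d. cyc n (q k)) + e"
      using transversal_decompose[OF n b] by blast
    obtain T p where p: "q 0 \<le> p" "p + d = q 0 + T * m" "p mod n = q 0 mod n" and T: "T \<le> d * (n div d)"
      and A: "arc n (q 0) (p - q 0) + (\<Sum>k\<in>{0..<d}. cyc n (q k)) \<in> exps_power n (path_exps n m) T"
      using walk[OF d_def n m, of q d] q d by auto
    define X where "X = p - q 0"
    have X: "X + d = T * m" using p by (simp add: X_def)
    have "n dvd X" using p by (metis X_def mod_eq_dvd_iff_nat)
    then obtain x where x: "X = x * n" by (metis dvd_def mult.commute)
    \<comment> \<open>The walk only gives \<open>T \<le> n\<close>, while the threshold is a maximum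
      over numbers up to \<open>n - 1\<close>. For \<open>T = n\<close> both \<open>X\<close> and
      \<open>X + d\<close> would be multiples of \<open>n\<close>, but
      \<open>0 < d < n\<close>.\<close>
    have "T \<noteq> n"
    proof
      assume "T = n"
      then have "n dvd d" using X \<open>n dvd X\<close> by (metis dvd_add_right_iff dvd_triv_left)
      then have "n \<le> d" using d by (simp add: dvd_imp_le)
      moreover have "d \<le> m" using d m by (simp add: dvd_imp_le)
      ultimately show False using mn by simp
    qed
    then have Tn: "T \<le> n - 1" using T d by simp
    have "T \<le> t0"
    proof (rule ccontr)
      assume "\<not> T \<le> t0"
      then have "m * t0 < m * T" using m by simp
      \<comment> \<open>The threshold ranges only over equations with a positive multiple of
        \<open>n\<close>. Here \<open>X > \<alpha> * n\<close>, as \<open>m * T\<close> exceeds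
        \<open>m * t0\<close>.\<close>
      then have "0 < x" using X \<alpha> x by (cases x) (auto simp: mult.commute)
      then have "T \<le> threshold n m"
        using le_threshold[OF mn Tn, of x] X x by (simp add: d_def mult.commute)
      with \<open>\<not> T \<le> t0\<close> show False by (simp add: t0_def)
    qed
    \<comment> \<open>Subtracting \<open>m * T = X + d\<close> from
      \<open>m * t0 = \<alpha> * n + d\<close> cancels \<open>d\<close>, so the rest of the windings
      consists of whole blocks.\<close>
    have "\<alpha> * n = X + (t0 - T) * m"
    proof -
      have "t0 * m = T * m + (t0 - T) * m" using \<open>T \<le> t0\<close> by (simp flip: add_mult_distrib)
      then show ?thesis using \<alpha>(2) X by (simp add: mult.commute)
    qed
    then have "arc n 0 (\<alpha> * n) = arc n (q 0) X + arc n X ((t0 - T) * m)"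
      using arc_add[of n 0 X "(t0 - T) * m"] arc_closed[OF \<open>n dvd X\<close>, of "q 0"] by simp
    then have Wb: "W + b = (arc n (q 0) X + (\<Sum>k\<in>{0..<d}. cyc n (q k))) + arc n X ((t0 - T) * m)
        + arc n 0 ((t - t0) * m) + e"
      by (simp add: W_def be add_ac atLeast0LessThan)
    \<comment> \<open>The summand \<open>0\<close> accounts for \<open>e\<close>, an arbitrary
      exponent in the zeroth power.\<close>
    have "W + b \<in> exps_power n (path_exps n m) (T + (t0 - T) + (t - t0) + 0)"
      unfolding Wb using A e by (intro exps_power_add[OF up] arc_in_exps_power n) (simp_all add: X_def)
    then show ?thesis using \<open>T \<le> t0\<close> t by (simp add: t0_def)
  qed
  moreover have "W \<in> exps {1..n}"
    unfolding W_def by (intro exps_add arc_exps n)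
  ultimately show ?thesis using that unfolding d_def by blast
qed

section \<open>The module \<open>S/I\<close>\<close>

lemma quotient_module_sel:
  "carrier (quotient_module R I) = carrier (R Quot I)"
  "zero (quotient_module R I) = zero (R Quot I)"
  "add (quotient_module R I) = add (R Quot I)"
  "smult (quotient_module R I) = (\<lambda>a X. (I +>\<^bsub>R\<^esub> a) \<otimes>\<^bsub>R Quot I\<^esub> X)"
  by (simp_all add: quotient_module_def ring.defs)

lemma carrier_quotient_module:
  "carrier (quotient_module R I) = (\<lambda>p. I +>\<^bsub>R\<^esub> p) ` carrier R"
  unfolding quotient_module_sel FactRing_def partial_object.simps A_RCOSETS_def' by blast

context
  fixes n :: nat and I :: "'k::field mpoly set"
  assumes I: "ideal I (mpoly_ring n)"
begin

interpretation cring "mpoly_ring n :: 'k mpoly ring" by (rule cring_mpoly_ring)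
interpretation I: ideal I "mpoly_ring n" by (rule I)
interpretation Q: ring "mpoly_ring n Quot I" by (rule I.quotient_is_ring)
interpretation h: ring_hom_ring "mpoly_ring n" "mpoly_ring n Quot I" "(+>\<^bsub>mpoly_ring n\<^esub>) I"
  by (rule I.rcos_ring_hom_ring)

lemma coset_eq_iff:
  assumes "p \<in> carrier (mpoly_ring n)" "q \<in> carrier (mpoly_ring n)"
  shows "I +>\<^bsub>mpoly_ring n\<^esub> p = I +>\<^bsub>mpoly_ring n\<^esub> q \<longleftrightarrow> p - q \<in> I"
  using quotient_eq_iff_same_a_r_cos[OF I assms] assms by (simp add: a_minus_mpoly_ring)

lemma zero_quotient_module: "\<zero>\<^bsub>quotient_module (mpoly_ring n) I\<^esub> = I +>\<^bsub>mpoly_ring n\<^esub> 0"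
  using h.hom_zero by (simp add: quotient_module_sel mpoly_ring_simps)

lemma smult_quotient_module:
  assumes "u \<in> carrier (mpoly_ring n)" "p \<in> carrier (mpoly_ring n)"
  shows "u \<odot>\<^bsub>quotient_module (mpoly_ring n) I\<^esub> (I +>\<^bsub>mpoly_ring n\<^esub> p) = I +>\<^bsub>mpoly_ring n\<^esub> (u * p)"
  using assms h.hom_mult[of u p] by (simp add: quotient_module_sel mpoly_ring_simps)

lemma abelian_group_quotient_module: "abelian_group (quotient_module (mpoly_ring n) I)"
  using module_quotient_module[OF is_cring I] by (simp add: module_def)

lemma finsum_quotient_module:
  assumes "finite X" "\<And>i. i \<in> X \<Longrightarrow> f i \<in> carrier (mpoly_ring n)"
  shows "(\<Oplus>\<^bsub>quotient_module (mpoly_ring n) I\<^esub>i\<in>X. I +>\<^bsub>mpoly_ring n\<^esub> f i) = I +>\<^bsub>mpoly_ring n\<^esub> sum f X"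
proof -
  interpret M: abelian_group "quotient_module (mpoly_ring n) I"
    by (rule abelian_group_quotient_module)
  show ?thesis using assms
  proof (induction X rule: finite_induct)
    case empty
    show ?case by (simp add: M.finsum_empty zero_quotient_module)
  next
    case (insert i X)
    have carr: "I +>\<^bsub>mpoly_ring n\<^esub> f j \<in> carrier (quotient_module (mpoly_ring n) I)"
      if "j \<in> insert i X" for j
      using insert.prems[OF that] by (auto simp: carrier_quotient_module)
    have "sum f X \<in> carrier (mpoly_ring n)"
      using insert.prems unfolding carrier_mpoly_ring by (intro mono_span_sum) auto
    then show ?case
      using insert carr h.hom_add[of "f i" "sum f X"]
      by (simp add: M.finsum_insert Pi_def quotient_module_sel mpoly_ring_simps)
  qed
qed

end

lemma coset_mono_span_eq_iff:
  assumes "up_closed n A" "p \<in> mono_span (exps {1..n})" "q \<in> mono_span (exps {1..n})"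
  shows "mono_span A +>\<^bsub>mpoly_ring n\<^esub> p = mono_span A +>\<^bsub>mpoly_ring n\<^esub> q \<longleftrightarrow>
    (\<forall>b. b \<notin> A \<longrightarrow> lookup p b = lookup q b)"
  using coset_eq_iff[OF ideal_mono_span[OF assms(1)], unfolded carrier_mpoly_ring, OF assms(2,3)]
  by (simp add: mono_span_iff lookup_minus)

section \<open>Stanley decompositions of \<open>S/I\<close> as partitions of the monomials outside \<open>I\<close>\<close>

definition cell :: "(nat \<Rightarrow>\<^sub>0 nat) \<Rightarrow> nat set \<Rightarrow> (nat \<Rightarrow>\<^sub>0 nat) set"
  where "cell b Z = {b + c |c. c \<in> exps Z}"

text \<open>Counting list entries, rather than requiring disjoint sets, also excludes repeated
  entries, in line with decompositions being lists. That cells avoid \<open>A\<close> is what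
  freeness of the Stanley spaces becomes.\<close>

definition monomial_partition ::
    "nat \<Rightarrow> (nat \<Rightarrow>\<^sub>0 nat) set \<Rightarrow> ((nat \<Rightarrow>\<^sub>0 nat) \<times> nat set) list \<Rightarrow> bool"
  where "monomial_partition n A L \<longleftrightarrow>
    (\<forall>(b, Z)\<in>set L. b \<in> exps {1..n} \<and> Z \<subseteq> {1..n} \<and> cell b Z \<inter> A = {}) \<and>
    (\<forall>c\<in>exps {1..n} - A. length (filter (\<lambda>(b, Z). c \<in> cell b Z) L) = 1)"

lemma exps_mono: "Y \<subseteq> Z \<Longrightarrow> exps Y \<subseteq> exps Z"
  by (auto simp: exps_def)

lemma cell_subset_exps: "b \<in> exps X \<Longrightarrow> Z \<subseteq> X \<Longrightarrow> cell b Z \<subseteq> exps X"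
  using exps_mono[of Z X] by (auto simp: cell_def intro: exps_add)

lemma in_cell_iff:
  "c \<in> cell b Z \<longleftrightarrow> (\<forall>i. lookup b i \<le> lookup c i \<and> (i \<notin> Z \<longrightarrow> lookup c i = lookup b i))"
proof
  assume r: "\<forall>i. lookup b i \<le> lookup c i \<and> (i \<notin> Z \<longrightarrow> lookup c i = lookup b i)"
  then have "c = b + (c - b)"
    by (intro poly_mapping_eqI) (simp add: lookup_add lookup_minus)
  moreover have "c - b \<in> exps Z"
    using r by (auto simp: exps_def in_keys_iff lookup_minus)
  ultimately show "c \<in> cell b Z" unfolding cell_def by blast
qed (auto simp: cell_def lookup_add exps_def in_keys_iff)

lemma stanley_space_quotient:
  fixes k :: "'k::field"
  assumes A: "up_closed n A" and b: "b \<in> exps {1..n}" and Z: "Z \<subseteq> {1..n}" and k: "k \<noteq> 0"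
  shows "stanley_space (quotient_module (mpoly_ring n) (mono_span A)) (mono_span A +>\<^bsub>mpoly_ring n\<^esub> single b k, Z)
    = (\<lambda>p. mono_span A +>\<^bsub>mpoly_ring n\<^esub> p) ` mono_span (cell b Z)"
proof -
  have eq: "(\<lambda>u. u * single b k) ` mono_span (exps Z) = mono_span (cell b Z)"
  proof (intro equalityI subsetI)
    fix p :: "'k mpoly" assume p: "p \<in> mono_span (cell b Z)"
    define u where "u = (\<Sum>e\<in>keys p. single (e - b) (lookup p e / k))"
    have e: "e = (e - b) + b \<and> e - b \<in> exps Z" if ek: "e \<in> keys p" for e
    proof -
      obtain c where "e = b + c" "c \<in> exps Z"
        using p ek unfolding mono_span_def cell_def by blast
      then show ?thesis by (simp add: add.commute)
    qed
    then have "u \<in> mono_span (exps Z)"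
      unfolding u_def by (intro mono_span_sum mono_span_single) blast
    moreover have "u * single b k = (\<Sum>e\<in>keys p. single e (lookup p e))"
      unfolding u_def sum_distrib_right
    proof (rule sum.cong[OF refl])
      fix e assume "e \<in> keys p"
      then show "single (e - b) (lookup p e / k) * single b k = single e (lookup p e)"
        using e[of e] k by (simp add: mult_single)
    qed
    ultimately show "p \<in> (\<lambda>u. u * single b k) ` mono_span (exps Z)"
      by (auto simp: sum_singles)
  next
    fix p assume "p \<in> (\<lambda>u. u * single b k) ` mono_span (exps Z)"
    then obtain u where u: "p = single b k * u" "u \<in> mono_span (exps Z)" by (auto simp: mult.commute)
    show "p \<in> mono_span (cell b Z)"
      unfolding u(1) by (rule mono_span_mult[OF mono_span_single[of b "{b}"] u(2)]) (auto simp: cell_def)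
  qed
  have sub: "mono_span (exps Z) \<subseteq> carrier (mpoly_ring n)"
    unfolding carrier_mpoly_ring by (intro mono_span_mono exps_mono Z)
  have "single b k \<in> carrier (mpoly_ring n)"
    unfolding carrier_mpoly_ring by (rule mono_span_single[OF b])
  then have "stanley_space (quotient_module (mpoly_ring n) (mono_span A)) (mono_span A +>\<^bsub>mpoly_ring n\<^esub> single b k, Z)
    = (\<lambda>u. mono_span A +>\<^bsub>mpoly_ring n\<^esub> (u * single b k)) ` mono_span (exps Z)"
    unfolding stanley_space_def mpolys_eq fst_conv snd_conv
    using sub by (intro image_cong refl smult_quotient_module[OF ideal_mono_span[OF A]]) blast+
  then show ?thesis unfolding eq[symmetric] by (simp only: image_image)
qed

text \<open>Modulo the ideal a polynomial is known by its coefficients outside \<open>A\<close>.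
  Each such exponent lies in exactly one cell, so the components of a residue class are obtained,
  and are determined, by sorting the terms of a representative into the cells.\<close>

lemma monomial_partition_stanley:
  assumes A: "up_closed n A" and L: "monomial_partition n A L"
  shows "stanley_decomposition n (quotient_module (mpoly_ring n) (mono_span A))
    (quotient_grading n (mono_span A :: 'k::field mpoly set))
    (map (\<lambda>(b, Z). (mono_span A +>\<^bsub>mpoly_ring n\<^esub> monom b, Z)) L)"
    (is "stanley_decomposition n ?M ?G ?D")
proof -
  have I: "ideal (mono_span A) (mpoly_ring n :: 'k mpoly ring)"
    by (rule ideal_mono_span[OF A])
  define cl where "cl = (\<lambda>p :: 'k mpoly. mono_span A +>\<^bsub>mpoly_ring n\<^esub> p)"
  have cl_eq: "cl p = cl q \<longleftrightarrow> (\<forall>b. b \<notin> A \<longrightarrow> lookup p b = lookup q b)"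
    if "p \<in> mono_span (exps {1..n})" "q \<in> mono_span (exps {1..n})" for p q
    unfolding cl_def by (rule coset_mono_span_eq_iff[OF A that])
  have L1: "b \<in> exps {1..n}" "Z \<subseteq> {1..n}" "cell b Z \<inter> A = {}" if "(b, Z) \<in> set L" for b Z
    using L that by (auto simp: monomial_partition_def)
  define b where "b j = fst (L ! j)" for j
  define Z where "Z j = snd (L ! j)" for j
  have Lj: "(b j, Z j) \<in> set L" if "j < length L" for j
    using that by (simp add: b_def Z_def)
  have cell_exps: "mono_span (cell (b j) (Z j)) \<subseteq> (mono_span (exps {1..n}) :: 'k mpoly set)" if "j < length L" for j
    using L1[OF Lj[OF that]] by (intro mono_span_mono cell_subset_exps)
  have space: "stanley_space ?M (?D ! j) = cl ` mono_span (cell (b j) (Z j))" if "j < length L" for j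
  proof -
    have "?D ! j = (mono_span A +>\<^bsub>mpoly_ring n\<^esub> single (b j) 1, Z j)"
      using that by (simp add: b_def Z_def monom_def split_def)
    then show ?thesis
      using stanley_space_quotient[OF A L1(1,2)[OF Lj[OF that]], of 1] by (simp add: cl_def)
  qed
  have uniq: "\<exists>j<length L. c \<in> cell (b j) (Z j)"
    "\<lbrakk>i < length L; j < length L; c \<in> cell (b i) (Z i); c \<in> cell (b j) (Z j)\<rbrakk> \<Longrightarrow> i = j"
    if "c \<in> exps {1..n}" "c \<notin> A" for c i j
  proof -
    have "card {i. i < length L \<and> c \<in> cell (b i) (Z i)} = 1"
      using L that unfolding monomial_partition_def
      by (auto simp: length_filter_conv_card b_def Z_def split_def)
    then obtain k where "{i. i < length L \<and> c \<in> cell (b i) (Z i)} = {k}"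
      by (auto simp: card_1_singleton_iff)
    then have k: "i < length L \<and> c \<in> cell (b i) (Z i) \<longleftrightarrow> i = k" for i
      by (simp add: set_eq_iff)
    show "\<exists>j<length L. c \<in> cell (b j) (Z j)" using k[of k] by auto
    show "\<lbrakk>i < length L; j < length L; c \<in> cell (b i) (Z i); c \<in> cell (b j) (Z j)\<rbrakk> \<Longrightarrow> i = j"
      using k[of i] k[of j] by simp
  qed
  have exuniq: "\<exists>!f. f \<in> (\<Pi>\<^sub>E j\<in>{..<length ?D}. stanley_space ?M (?D ! j)) \<and>
      w = (\<Oplus>\<^bsub>?M\<^esub>j\<in>{..<length ?D}. f j)" if "w \<in> carrier ?M" for w
  proof -
    obtain p where w: "w = cl p" and p: "p \<in> mono_span (exps {1..n})"
      using \<open>w \<in> carrier ?M\<close> unfolding carrier_quotient_module cl_def carrier_mpoly_ring by blast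
    define P where "P j = (\<Sum>e\<in>keys p \<inter> cell (b j) (Z j). single e (lookup p e))" for j
    have lookP: "lookup (P j) c = (if c \<in> cell (b j) (Z j) then lookup p c else 0)" for j c
    proof -
      have "lookup (P j) c = (\<Sum>e\<in>keys p \<inter> cell (b j) (Z j). if e = c then lookup p e else 0)"
        by (simp add: P_def lookup_sum lookup_single when_def)
      then show ?thesis by (simp add: in_keys_iff)
    qed
    have P: "P j \<in> mono_span (cell (b j) (Z j))" for j
      unfolding P_def by (intro mono_span_sum mono_span_single) simp
    have finsum: "(\<Oplus>\<^bsub>?M\<^esub>j\<in>{..<length L}. cl (R j)) = cl (\<Sum>j<length L. R j)"
      if "\<And>j. j < length L \<Longrightarrow> R j \<in> mono_span (cell (b j) (Z j))" for R
      unfolding cl_def using that cell_exps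
      by (intro finsum_quotient_module[OF I]) (auto simp: carrier_mpoly_ring)
    have sum_exps: "(\<Sum>j<length L. R j) \<in> mono_span (exps {1..n})"
      if "\<And>j. j < length L \<Longrightarrow> R j \<in> mono_span (cell (b j) (Z j))" for R :: "nat \<Rightarrow> 'k mpoly"
      using that cell_exps by (intro mono_span_sum) auto
    have coeff: "lookup (\<Sum>j<length L. R j) c = lookup (R j) c"
      if "c \<notin> A" "j < length L" "c \<in> cell (b j) (Z j)"
        "\<And>j. j < length L \<Longrightarrow> R j \<in> mono_span (cell (b j) (Z j))" for R :: "nat \<Rightarrow> 'k mpoly" and c j
    proof -
      have "c \<in> exps {1..n}"
        using that(3) cell_subset_exps[OF L1(1,2)[OF Lj[OF that(2)]]] by blast
      then have j: "i = j" if "i < length L" "c \<in> cell (b i) (Z i)" for i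
        using uniq(2)[of c i j] that \<open>c \<notin> A\<close> \<open>j < length L\<close> \<open>c \<in> cell (b j) (Z j)\<close> by simp
      have "(\<Sum>i<length L. lookup (R i) c) = (\<Sum>i\<in>{j}. lookup (R i) c)"
      proof (rule sum.mono_neutral_right)
        show "\<forall>i\<in>{..<length L} - {j}. lookup (R i) c = 0"
        proof
          fix i assume i: "i \<in> {..<length L} - {j}"
          then have "c \<notin> cell (b i) (Z i)" using j[of i] by auto
          then show "lookup (R i) c = 0" using that(4)[of i] i by (simp add: mono_span_iff)
        qed
      qed (use that in auto)
      then show ?thesis by (simp add: lookup_sum)
    qed
    have "cl p = cl (\<Sum>j<length L. P j)"
      unfolding cl_eq[OF p sum_exps[OF P]]
    proof (intro allI impI)
      fix c assume c: "c \<notin> A"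
      show "lookup p c = lookup (\<Sum>j<length L. P j) c"
      proof (cases "c \<in> exps {1..n}")
        case True
        then obtain j where "j < length L" "c \<in> cell (b j) (Z j)" using uniq(1)[OF True c] by auto
        then show ?thesis using coeff[OF c _ _ P] lookP by simp
      next
        case False
        then have "lookup q c = 0" if "q \<in> mono_span (exps {1..n})" for q :: "'k mpoly"
          using that by (simp add: mono_span_iff)
        from this[OF p] this[OF sum_exps[OF P]] show ?thesis by simp
      qed
    qed
    then have wP: "w = (\<Oplus>\<^bsub>?M\<^esub>j\<in>{..<length L}. cl (P j))"
      using finsum[OF P] w by simp
    show ?thesis
    proof (rule ex_ex1I)
      interpret M: abelian_group ?M
        by (rule abelian_group_quotient_module[OF I])
      have "cl (P j) \<in> carrier ?M" if "j < length L" for j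
        using P[of j] cell_exps[OF that] by (auto simp: carrier_quotient_module cl_def carrier_mpoly_ring)
      then have "w = (\<Oplus>\<^bsub>?M\<^esub>j\<in>{..<length L}. (\<lambda>j\<in>{..<length L}. cl (P j)) j)"
        unfolding wP by (intro M.finsum_cong') auto
      moreover have "(\<lambda>j\<in>{..<length L}. cl (P j)) \<in> (\<Pi>\<^sub>E j\<in>{..<length ?D}. stanley_space ?M (?D ! j))"
        using space P by auto
      ultimately show "\<exists>f. f \<in> (\<Pi>\<^sub>E j\<in>{..<length ?D}. stanley_space ?M (?D ! j)) \<and>
          w = (\<Oplus>\<^bsub>?M\<^esub>j\<in>{..<length ?D}. f j)"
        by (intro exI[of _ "\<lambda>j\<in>{..<length L}. cl (P j)"]) simp
    next
      interpret M: abelian_group ?M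
        by (rule abelian_group_quotient_module[OF I])
      have rep: "\<exists>R. (\<forall>j<length L. R j \<in> mono_span (cell (b j) (Z j)) \<and> f j = cl (R j)) \<and>
          w = cl (\<Sum>j<length L. R j)"
        if f: "f \<in> (\<Pi>\<^sub>E j\<in>{..<length ?D}. stanley_space ?M (?D ! j))" "w = (\<Oplus>\<^bsub>?M\<^esub>j\<in>{..<length ?D}. f j)" for f
      proof -
        have "\<forall>j. \<exists>r. j < length L \<longrightarrow> r \<in> mono_span (cell (b j) (Z j)) \<and> f j = cl r"
        proof (intro allI)
          fix j
          have "j < length L \<Longrightarrow> f j \<in> cl ` mono_span (cell (b j) (Z j))"
            using f(1) space[of j] by (auto simp: PiE_iff)
          then show "\<exists>r. j < length L \<longrightarrow> r \<in> mono_span (cell (b j) (Z j)) \<and> f j = cl r" by blast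
        qed
        then obtain R where R: "\<And>j. j < length L \<Longrightarrow> R j \<in> mono_span (cell (b j) (Z j)) \<and> f j = cl (R j)"
          by metis
        have "cl (R j) \<in> carrier ?M" if "j < length L" for j
          using R[of j] cell_exps[OF that] that by (auto simp: carrier_quotient_module cl_def carrier_mpoly_ring)
        then have "w = (\<Oplus>\<^bsub>?M\<^esub>j\<in>{..<length L}. cl (R j))"
          unfolding f(2) using R by (intro M.finsum_cong') auto
        then have "w = cl (\<Sum>j<length L. R j)" using finsum R by simp
        with R show ?thesis by blast
      qed
      fix f g
      assume f: "f \<in> (\<Pi>\<^sub>E j\<in>{..<length ?D}. stanley_space ?M (?D ! j)) \<and> w = (\<Oplus>\<^bsub>?M\<^esub>j\<in>{..<length ?D}. f j)"
        and g: "g \<in> (\<Pi>\<^sub>E j\<in>{..<length ?D}. stanley_space ?M (?D ! j)) \<and> w = (\<Oplus>\<^bsub>?M\<^esub>j\<in>{..<length ?D}. g j)"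
      obtain R where R: "\<And>j. j < length L \<Longrightarrow> R j \<in> mono_span (cell (b j) (Z j))"
        "\<And>j. j < length L \<Longrightarrow> f j = cl (R j)" "w = cl (\<Sum>j<length L. R j)"
        using rep[of f] f by blast
      obtain S where S: "\<And>j. j < length L \<Longrightarrow> S j \<in> mono_span (cell (b j) (Z j))"
        "\<And>j. j < length L \<Longrightarrow> g j = cl (S j)" "w = cl (\<Sum>j<length L. S j)"
        using rep[of g] g by blast
      have "f j = g j" if j: "j < length L" for j
      proof -
        have "cl (R j) = cl (S j)"
          unfolding cl_eq[OF subsetD[OF cell_exps[OF j] R(1)[OF j]] subsetD[OF cell_exps[OF j] S(1)[OF j]]]
        proof (intro allI impI)
          fix c assume c: "c \<notin> A"
          have eq: "lookup (\<Sum>j<length L. R j) c = lookup (\<Sum>j<length L. S j) c"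
            using R(3) S(3) cl_eq[OF sum_exps[OF R(1)] sum_exps[OF S(1)]] c by simp
          show "lookup (R j) c = lookup (S j) c"
          proof (cases "c \<in> cell (b j) (Z j)")
            case True
            then show ?thesis using eq coeff[OF c j True R(1)] coeff[OF c j True S(1)] by simp
          next
            case False
            then show ?thesis using R(1)[OF j] S(1)[OF j] by (simp add: mono_span_iff)
          qed
        qed
        then show ?thesis using R(2) S(2) j by simp
      qed
      then show "f = g"
        by (intro PiE_ext[OF conjunct1[OF f] conjunct1[OF g]]) simp
    qed
  qed
  have gen: "v \<in> carrier ?M \<and> (\<exists>a. v \<in> ?G a) \<and> Y \<subseteq> {1..n} \<and>
      (\<forall>u\<in>mpolys Y. u \<odot>\<^bsub>?M\<^esub> v = \<zero>\<^bsub>?M\<^esub> \<longrightarrow> u = 0)" if vY: "(v, Y) \<in> set ?D" for v Y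
  proof -
    obtain e where e: "(e, Y) \<in> set L" and v: "v = cl (monom e)"
      using vY by (auto simp: cl_def)
    have mon: "monom e \<in> carrier (mpoly_ring n)"
      using L1[OF e] by (simp add: carrier_mpoly_ring mono_span_monom_iff)
    have "v \<in> carrier ?M"
      unfolding v cl_def carrier_quotient_module by (rule imageI[OF mon])
    moreover have "v \<in> ?G (\<lambda>i. int (lookup e i))"
      unfolding quotient_grading_def mem_Collect_eq v cl_def
      by (rule exI[of _ "monom e"]) (use mon in \<open>simp add: monom_def\<close>)
    moreover have "u = 0" if u: "u \<in> mpolys Y" "u \<odot>\<^bsub>?M\<^esub> v = \<zero>\<^bsub>?M\<^esub>" for u
    proof -
      have uc: "u \<in> mono_span (exps {1..n})"
        using u(1) mono_span_mono[OF exps_mono[OF L1(2)[OF e]]] by (auto simp: mpolys_eq)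
      then have "u \<in> carrier (mpoly_ring n)" by (simp only: carrier_mpoly_ring)
      from smult_quotient_module[OF I this mon] have "cl (u * monom e) = cl 0"
        using u(2) unfolding v cl_def zero_quotient_module[OF I] by (rule subst)
      moreover have "u * monom e \<in> mono_span (cell e Y)"
        unfolding monom_def
        by (subst mult.commute, rule mono_span_mult[OF mono_span_single[of e "{e}"] u(1)[unfolded mpolys_eq]]) (auto simp: cell_def)
      moreover from this have "u * monom e \<in> mono_span (exps {1..n})"
        by (rule subsetD[OF mono_span_mono[OF cell_subset_exps[OF L1(1,2)[OF e]]]])
      \<comment> \<open>The support of the product lies in a cell, and so outside \<open>A\<close>;
        being zero modulo the ideal therefore means being zero.\<close>
      ultimately have 0: "lookup (u * monom e) c = 0" for c
        using cl_eq[of "u * monom e" 0] L1(3)[OF e] by (cases "c \<in> A") (auto simp: mono_span_iff)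
      show "u = 0"
      proof (rule poly_mapping_eqI)
        fix c
        show "lookup u c = lookup 0 c"
          using 0[of "e + c"] lookup_single_mult_add[of e 1 u c] by (simp add: monom_def mult.commute)
      qed
    qed
    ultimately show ?thesis using L1[OF e] by blast
  qed
  show ?thesis
    unfolding stanley_decomposition_def
  proof (intro conjI ballI)
    fix x assume "x \<in> set ?D"
    moreover obtain v Y where x: "x = (v, Y)" by (cases x)
    ultimately have "(v, Y) \<in> set ?D" by (simp only:)
    from gen[OF this] show "case x of (v, Y) \<Rightarrow> v \<in> carrier ?M \<and> (\<exists>a. v \<in> ?G a) \<and> Y \<subseteq> {1..n} \<and>
      (\<forall>u\<in>mpolys Y. u \<odot>\<^bsub>?M\<^esub> v = \<zero>\<^bsub>?M\<^esub> \<longrightarrow> u = 0)"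
      unfolding x prod.case .
  qed (rule exuniq)
qed

text \<open>A multidegree determines the exponent on \<open>1..n\<close>, and outside that range all
  exponents vanish. So the graded components of the polynomial ring are at most
  one-dimensional.\<close>

lemma homogeneous_single:
  assumes p: "p \<in> mono_span (exps {1..n})" "p \<noteq> 0"
    and a: "\<forall>b\<in>keys p. \<forall>i\<in>{1..n}. int (lookup b i) = a i"
  shows "\<exists>b k. b \<in> exps {1..n} \<and> k \<noteq> 0 \<and> p = single b k"
proof -
  have "keys p \<noteq> {}" using p(2) sum_singles[of p] by auto
  then obtain b where b: "b \<in> keys p" by blast
  have "c = b" if c: "c \<in> keys p" for c
  proof (rule poly_mapping_eqI)
    fix i
    show "lookup c i = lookup b i"
    proof (cases "i \<in> {1..n}")
      case True
      then have "int (lookup c i) = int (lookup b i)" using a b c by simp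
      then show ?thesis by simp
    next
      case False
      moreover have "keys b \<subseteq> {1..n}" "keys c \<subseteq> {1..n}"
        using b c p(1) by (auto simp: mono_span_def exps_def)
      ultimately have "i \<notin> keys b" "i \<notin> keys c" by blast+
      then show ?thesis by (simp add: in_keys_iff)
    qed
  qed
  then have "keys p = {b}" using b by blast
  then have "p = single b (lookup p b)" using sum_singles[of p] by simp
  moreover have "lookup p b \<noteq> 0" "b \<in> exps {1..n}"
    using b p(1) by (auto simp: mono_span_def in_keys_iff)
  ultimately show ?thesis by (intro exI[of _ b] exI[of _ "lookup p b"] conjI)
qed

text \<open>Freeness is tested on monomials: \<open>u = 1\<close> shows that a homogeneous
  representative of \<open>v\<close> is nonzero, so that it is a scaled monomial, and
  \<open>u = monom c\<close> shows that its translate by \<open>c\<close> stays outside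
  \<open>A\<close>.\<close>

lemma stanley_generator:
  fixes A and M and v :: "'k::field mpoly set"
  assumes A: "up_closed n A" and M: "M = quotient_module (mpoly_ring n) (mono_span A)"
    and v: "v \<in> quotient_grading n (mono_span A) a" and Z: "Z \<subseteq> {1..n}"
    and free: "\<forall>u\<in>mpolys Z. u \<odot>\<^bsub>M\<^esub> v = \<zero>\<^bsub>M\<^esub> \<longrightarrow> u = 0"
  shows "\<exists>b k. b \<in> exps {1..n} \<and> k \<noteq> 0 \<and> v = mono_span A +>\<^bsub>mpoly_ring n\<^esub> single b k \<and> cell b Z \<inter> A = {}"
proof -
  have I: "ideal (mono_span A) (mpoly_ring n :: 'k mpoly ring)"
    by (rule ideal_mono_span[OF A])
  obtain p where p: "v = mono_span A +>\<^bsub>mpoly_ring n\<^esub> p" "p \<in> carrier (mpoly_ring n)"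
    "\<forall>b\<in>keys p. \<forall>i\<in>{1..n}. int (lookup b i) = a i"
    using v unfolding quotient_grading_def by blast
  have smult0: "u = 0" if "u \<in> mono_span (exps Z)" "u * p \<in> mono_span A" for u
  proof -
    have u: "u \<in> carrier (mpoly_ring n)"
      unfolding carrier_mpoly_ring using that(1) mono_span_mono[OF exps_mono[OF Z]] by blast
    have "u * p \<in> carrier (mpoly_ring n)"
      using that(2) A mono_span_mono[of A "exps {1..n}"] by (auto simp: carrier_mpoly_ring up_closed_def)
    moreover have "(0 :: 'k mpoly) \<in> carrier (mpoly_ring n)"
      by (simp add: carrier_mpoly_ring)
    ultimately have "mono_span A +>\<^bsub>mpoly_ring n\<^esub> (u * p) = mono_span A +>\<^bsub>mpoly_ring n\<^esub> 0"
      using coset_eq_iff[OF I, of "u * p" 0] that(2) by simp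
    then have "u \<odot>\<^bsub>M\<^esub> v = \<zero>\<^bsub>M\<^esub>"
      unfolding M p(1) smult_quotient_module[OF I u p(2)] zero_quotient_module[OF I] .
    then show "u = 0" using free that(1) by (simp add: mpolys_eq)
  qed
  have "p \<noteq> 0"
  proof
    assume "p = 0"
    then have "(1 :: 'k mpoly) = 0"
      by (intro smult0) (simp_all add: mono_span_monom_iff flip: monom_zero)
    then show False by simp
  qed
  then obtain b k where b: "b \<in> exps {1..n}" "k \<noteq> 0" "p = single b k"
    using homogeneous_single[OF _ _ p(3)] p(2) by (auto simp: carrier_mpoly_ring)
  have "b + c \<notin> A" if "c \<in> exps Z" for c
  proof
    assume "b + c \<in> A"
    then have "(monom c :: 'k mpoly) = 0"
      using that b by (intro smult0)
        (simp_all add: mono_span_monom_iff monom_def mult_single add.commute mono_span_single)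
    then have "lookup (monom c :: 'k mpoly) c = 0" by simp
    then show False by (simp add: monom_def)
  qed
  then have "cell b Z \<inter> A = {}" by (auto simp: cell_def)
  then show ?thesis using b p(1) by blast
qed

text \<open>Existence and uniqueness of the decomposition are applied to a monomial with exponent
  \<open>c\<close> outside \<open>A\<close>. If no cell contained \<open>c\<close>, every sum of
  components would have coefficient 0 there; if two did, placing the monomial entirely in either
  component would give two decompositions. Only the sets \<open>Z\<close> have to agree with those
  of \<open>D\<close>, as the Stanley depth depends on nothing else.\<close>

lemma stanley_monomial_partition:
  fixes D :: "('k::field mpoly set \<times> nat set) list"
  assumes A: "up_closed n A"
    and D: "stanley_decomposition n (quotient_module (mpoly_ring n) (mono_span A))
      (quotient_grading n (mono_span A)) D"
      (is "stanley_decomposition n ?M ?G D")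
  obtains L where "map snd L = map snd D" "monomial_partition n A L"
proof -
  have I: "ideal (mono_span A) (mpoly_ring n :: 'k mpoly ring)"
    by (rule ideal_mono_span[OF A])
  define cl where "cl = (\<lambda>p :: 'k mpoly. mono_span A +>\<^bsub>mpoly_ring n\<^esub> p)"
  have cl_eq: "cl p = cl q \<longleftrightarrow> (\<forall>b. b \<notin> A \<longrightarrow> lookup p b = lookup q b)"
    if "p \<in> mono_span (exps {1..n})" "q \<in> mono_span (exps {1..n})" for p q
    unfolding cl_def by (rule coset_mono_span_eq_iff[OF A that])
  interpret M: abelian_group ?M
    by (rule abelian_group_quotient_module[OF I])
  define Z where "Z j = snd (D ! j)" for j
  have D1: "Z j \<subseteq> {1..n} \<and> (\<exists>b k. b \<in> exps {1..n} \<and> k \<noteq> 0 \<and> D ! j = (cl (single b k), Z j) \<and> cell b (Z j) \<inter> A = {})"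
    if j: "j < length D" for j
  proof -
    have "(fst (D ! j), Z j) \<in> set D" using j by (simp add: Z_def)
    from bspec[OF conjunct1[OF D[unfolded stanley_decomposition_def]] this]
    have *: "fst (D ! j) \<in> carrier ?M \<and> (\<exists>a. fst (D ! j) \<in> ?G a) \<and> Z j \<subseteq> {1..n} \<and>
      (\<forall>u\<in>mpolys (Z j). u \<odot>\<^bsub>?M\<^esub> fst (D ! j) = \<zero>\<^bsub>?M\<^esub> \<longrightarrow> u = 0)"
      unfolding prod.case .
    then obtain a where a: "fst (D ! j) \<in> ?G a" by blast
    from * have Zj: "Z j \<subseteq> {1..n}" by (elim conjE)
    from * have free: "\<forall>u\<in>mpolys (Z j). u \<odot>\<^bsub>?M\<^esub> fst (D ! j) = \<zero>\<^bsub>?M\<^esub> \<longrightarrow> u = 0"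
      by (elim conjE)
    from stanley_generator[OF A refl a Zj free]
    obtain b k where "b \<in> exps {1..n}" "k \<noteq> 0" "fst (D ! j) = cl (single b k)" "cell b (Z j) \<inter> A = {}"
      unfolding cl_def by blast
    moreover have "D ! j = (fst (D ! j), Z j)" by (simp add: Z_def)
    ultimately show ?thesis using Zj by auto
  qed
  then have "\<forall>j. \<exists>b. j < length D \<longrightarrow> (\<exists>k. b \<in> exps {1..n} \<and> k \<noteq> 0 \<and> D ! j = (cl (single b k), Z j) \<and> cell b (Z j) \<inter> A = {})"
    by blast
  then obtain b where b: "\<And>j. j < length D \<Longrightarrow> \<exists>k. b j \<in> exps {1..n} \<and> k \<noteq> 0 \<and> D ! j = (cl (single (b j) k), Z j) \<and> cell (b j) (Z j) \<inter> A = {}"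
    by metis
  have be: "b j \<in> exps {1..n}" "cell (b j) (Z j) \<inter> A = {}" "Z j \<subseteq> {1..n}" if "j < length D" for j
    using b[OF that] D1[OF that] by blast+
  have space: "stanley_space ?M (D ! j) = cl ` mono_span (cell (b j) (Z j))" if j: "j < length D" for j
  proof -
    obtain k where "k \<noteq> 0" "D ! j = (cl (single (b j) k), Z j)" using b[OF j] by blast
    then show ?thesis
      using stanley_space_quotient[OF A be(1,3)[OF j], of k] by (simp add: cl_def)
  qed
  have cell_exps: "mono_span (cell (b j) (Z j)) \<subseteq> (mono_span (exps {1..n}) :: 'k mpoly set)" if "j < length D" for j
    using be[OF that] by (intro mono_span_mono cell_subset_exps)
  have exuniq: "\<exists>!f. f \<in> (\<Pi>\<^sub>E j\<in>{..<length D}. stanley_space ?M (D ! j)) \<and> w = (\<Oplus>\<^bsub>?M\<^esub>j\<in>{..<length D}. f j)"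
    if "w \<in> carrier ?M" for w
    by (rule bspec[OF conjunct2[OF D[unfolded stanley_decomposition_def]] that])
  define L where "L = map (\<lambda>j. (b j, Z j)) [0..<length D]"
  have "length (filter (\<lambda>(b, Z). c \<in> cell b Z) L) = 1" if c: "c \<in> exps {1..n}" "c \<notin> A" for c
  proof -
    have monc: "(monom c :: 'k mpoly) \<in> mono_span (exps {1..n})" using c by (simp add: mono_span_monom_iff)
    define w where "w = cl (monom c)"
    have w: "w \<in> carrier ?M"
      unfolding w_def cl_def carrier_quotient_module carrier_mpoly_ring by (rule imageI[OF monc])
    have cl0: "cl 0 = \<zero>\<^bsub>?M\<^esub>"
      by (simp only: cl_def zero_quotient_module[OF I])
    have w0: "w \<noteq> cl 0"
      using cl_eq[OF monc, of 0] c by (auto simp: w_def monom_def)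
    have "\<exists>j<length D. c \<in> cell (b j) (Z j)"
    proof (rule ccontr)
      assume none: "\<not> (\<exists>j<length D. c \<in> cell (b j) (Z j))"
      obtain f where f: "f \<in> (\<Pi>\<^sub>E j\<in>{..<length D}. stanley_space ?M (D ! j))" "w = (\<Oplus>\<^bsub>?M\<^esub>j\<in>{..<length D}. f j)"
        using exuniq[OF w] by blast
      have "\<forall>j. \<exists>r. j < length D \<longrightarrow> r \<in> mono_span (cell (b j) (Z j)) \<and> f j = cl r"
      proof
        fix j
        have "j < length D \<Longrightarrow> f j \<in> cl ` mono_span (cell (b j) (Z j))"
          using f(1) space[of j] by (auto simp: PiE_iff)
        then show "\<exists>r. j < length D \<longrightarrow> r \<in> mono_span (cell (b j) (Z j)) \<and> f j = cl r" by blast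
      qed
      then obtain R where R: "\<And>j. j < length D \<Longrightarrow> R j \<in> mono_span (cell (b j) (Z j)) \<and> f j = cl (R j)"
        by metis
      have Re: "R j \<in> mono_span (exps {1..n})" if "j < length D" for j
        using R[OF that] cell_exps[OF that] by blast
      have "w = (\<Oplus>\<^bsub>?M\<^esub>j\<in>{..<length D}. cl (R j))"
        unfolding f(2) using R Re
        by (intro M.finsum_cong') (auto simp: carrier_quotient_module cl_def carrier_mpoly_ring)
      also have "\<dots> = cl (\<Sum>j<length D. R j)"
        unfolding cl_def using Re by (intro finsum_quotient_module[OF I]) (simp_all add: carrier_mpoly_ring)
      finally have eq: "cl (monom c) = cl (\<Sum>j<length D. R j)" by (simp only: w_def)
      have "(\<Sum>j<length D. R j) \<in> mono_span (exps {1..n})"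
        using Re by (intro mono_span_sum) simp
      from eq[unfolded cl_eq[OF monc this]] c(2)
      have "lookup (monom c :: 'k mpoly) c = lookup (\<Sum>j<length D. R j) c" by blast
      also have "\<dots> = 0"
        unfolding lookup_sum using R none by (intro sum.neutral) (auto simp: mono_span_iff)
      finally show False by (simp add: monom_def)
    qed
    moreover have "i = j" if ij: "i < length D" "j < length D" "c \<in> cell (b i) (Z i)" "c \<in> cell (b j) (Z j)" for i j
    proof (rule ccontr)
      assume "i \<noteq> j"
      define f where "f k = (\<lambda>l\<in>{..<length D}. if l = k then w else cl 0)" for k
      have f: "f k \<in> (\<Pi>\<^sub>E j\<in>{..<length D}. stanley_space ?M (D ! j)) \<and> w = (\<Oplus>\<^bsub>?M\<^esub>j\<in>{..<length D}. f k j)"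
        if k: "k < length D" "c \<in> cell (b k) (Z k)" for k
      proof
        have "f k l \<in> stanley_space ?M (D ! l)" if "l < length D" for l
          unfolding space[OF that] f_def using that k by (auto simp: w_def mono_span_monom_iff)
        then show "f k \<in> (\<Pi>\<^sub>E j\<in>{..<length D}. stanley_space ?M (D ! j))"
          by (auto simp: f_def)
        have "(\<Oplus>\<^bsub>?M\<^esub>j\<in>{..<length D}. f k j) = (\<Oplus>\<^bsub>?M\<^esub>j\<in>{..<length D}. if k = j then w else \<zero>\<^bsub>?M\<^esub>)"
          using w by (intro M.finsum_cong') (auto simp: f_def cl0)
        also have "\<dots> = w" using k w by (intro M.finsum_singleton) auto
        finally show "w = (\<Oplus>\<^bsub>?M\<^esub>j\<in>{..<length D}. f k j)" by (rule sym)
      qed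
      have "f i = f j" using exuniq[OF w] f[OF ij(1,3)] f[OF ij(2,4)] by blast
      then have "f i i = f j i" by simp
      then show False using \<open>i \<noteq> j\<close> w0 ij by (simp add: f_def)
    qed
    ultimately have "\<exists>j. {i. i < length D \<and> c \<in> cell (b i) (Z i)} = {j}"
      by blast
    then show ?thesis
      by (simp add: L_def filter_map o_def length_filter_conv_card card_1_singleton_iff cong: conj_cong)
  qed
  moreover have "map snd L = map snd D"
    by (rule nth_equalityI) (simp_all add: L_def Z_def)
  moreover have "\<forall>(b, Z)\<in>set L. b \<in> exps {1..n} \<and> Z \<subseteq> {1..n} \<and> cell b Z \<inter> A = {}"
    using be by (auto simp: L_def)
  ultimately show ?thesis using that[of L] unfolding monomial_partition_def by blast
qed

text \<open>Colons by a monomial cut the cells down: \<open>b - W\<close> is \<open>lcm(b, W) / W\<close> on exponents.\<close>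

lemma monomial_partition_colon:
  assumes L: "monomial_partition n A L" and W: "W \<in> exps {1..n}"
  shows "monomial_partition n {c \<in> exps {1..n}. W + c \<in> A}
    (map (\<lambda>(b, Z). (b - W, Z)) (filter (\<lambda>(b, Z). keys (W - b) \<subseteq> Z) L))"
    (is "monomial_partition n ?B ?L")
proof -
  \<comment> \<open>This explains the filter: outside \<open>Z\<close> all members of a cell agree
    with \<open>b\<close>, so the cell meets the multiples of \<open>x^W\<close> only if
    \<open>W\<close> is at most \<open>b\<close> there.\<close>
  have cell: "keys (W - b) \<subseteq> Z \<and> c \<in> cell (b - W) Z \<longleftrightarrow> W + c \<in> cell b Z" for b Z c
  proof -
    have "keys (W - b) \<subseteq> Z \<longleftrightarrow> (\<forall>i. i \<notin> Z \<longrightarrow> lookup W i \<le> lookup b i)"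
      by (auto simp: in_keys_iff lookup_minus subset_iff)
    then show ?thesis
      unfolding in_cell_iff lookup_add lookup_minus by (smt (verit) add.commute diff_add_inverse le_add_diff_inverse le_diff_conv le_add1 le_refl)
  qed
  have "b \<in> exps {1..n} \<and> Z \<subseteq> {1..n} \<and> cell b Z \<inter> ?B = {}" if bZ: "(b, Z) \<in> set ?L" for b Z
  proof -
    obtain b' where b': "(b', Z) \<in> set L" "keys (W - b') \<subseteq> Z" "b = b' - W" using bZ by auto
    then have *: "b' \<in> exps {1..n}" "Z \<subseteq> {1..n}" "cell b' Z \<inter> A = {}"
      using L by (auto simp: monomial_partition_def)
    then show ?thesis
      using b' cell[of b' Z] by (auto simp: exps_def in_keys_iff lookup_minus)
  qed
  moreover have "length (filter (\<lambda>(b, Z). c \<in> cell b Z) ?L) = 1" if "c \<in> exps {1..n} - ?B" for c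
  proof -
    have "filter (\<lambda>(b, Z). c \<in> cell b Z) ?L
        = map (\<lambda>(b, Z). (b - W, Z)) (filter (\<lambda>(b, Z). W + c \<in> cell b Z) L)"
      by (simp add: filter_map o_def split_def cell[symmetric] conj_commute)
    moreover have "W + c \<in> exps {1..n} - A" using that W exps_add by auto
    ultimately show ?thesis using L by (simp add: monomial_partition_def)
  qed
  ultimately show ?thesis unfolding monomial_partition_def by blast
qed

text \<open>Passing to the colon drops some cells and moves the others, but never changes a set
  \<open>Z\<close>; the minimum over fewer sets cannot decrease.\<close>

lemma quotient_sdepth_colon:
  assumes A: "up_closed n A" and W: "W \<in> exps {1..n}"
  shows "quotient_sdepth n (mono_span A :: 'k::field mpoly set)
    \<le> quotient_sdepth n (mono_span {c \<in> exps {1..n}. W + c \<in> A} :: 'k mpoly set)"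
    (is "_ \<le> quotient_sdepth n (mono_span ?B)")
  unfolding quotient_sdepth_def sdepth_def
proof (rule SUP_mono)
  have B: "up_closed n ?B"
    using A W unfolding up_closed_def by (auto simp: add.assoc[symmetric] intro: exps_add)
  fix D :: "('k mpoly set \<times> nat set) list"
  assume "D \<in> {D. stanley_decomposition n (quotient_module (mpoly_ring n) (mono_span A)) (quotient_grading n (mono_span A)) D}"
  then obtain L where L: "map snd L = map snd D" "monomial_partition n A L"
    using stanley_monomial_partition[OF A] by blast
  let ?L = "map (\<lambda>(b, Z). (b - W, Z)) (filter (\<lambda>(b, Z). keys (W - b) \<subseteq> Z) L)"
  let ?D = "map (\<lambda>(b, Z). (mono_span ?B +>\<^bsub>mpoly_ring n\<^esub> monom b :: 'k mpoly set, Z)) ?L"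
  have "stanley_decomposition n (quotient_module (mpoly_ring n) (mono_span ?B)) (quotient_grading n (mono_span ?B)) ?D"
    by (rule monomial_partition_stanley[OF B monomial_partition_colon[OF L(2) W]])
  then have "?D \<in> {D. stanley_decomposition n (quotient_module (mpoly_ring n) (mono_span ?B)) (quotient_grading n (mono_span ?B)) D}"
    by (rule CollectI)
  moreover have "decomposition_sdepth D \<le> decomposition_sdepth ?D"
  proof -
    have "snd ` set ?D \<subseteq> snd ` set L" by force
    also have "snd ` set L = snd ` set D" using L(1) by (metis list.set_map)
    finally have "(INF Z\<in>snd ` set D. enat (card Z)) \<le> (INF Z\<in>snd ` set ?D. enat (card Z))"
      by (rule INF_superset_mono) simp
    then show ?thesis unfolding decomposition_sdepth_def by (simp only: image_image)
  qed
  ultimately show "\<exists>D'\<in>{D :: ('k mpoly set \<times> nat set) list. stanley_decomposition n (quotient_module (mpoly_ring n) (mono_span ?B)) (quotient_grading n (mono_span ?B)) D}.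
      decomposition_sdepth D \<le> decomposition_sdepth D'" by (rule rev_bexI)
qed

text \<open>The cell that contains \<open>b\<close> cannot extend in a direction from
  \<open>X\<close>, since it would then meet \<open>A\<close>. So its \<open>Z\<close> is disjoint
  from \<open>X\<close>.\<close>

lemma quotient_sdepth_le:
  assumes A: "up_closed n A" and b: "b \<in> exps {1..n}" "b \<notin> A" and X: "X \<subseteq> {1..n}"
    and bX: "\<And>i. i \<in> X \<Longrightarrow> b + single i 1 \<in> A"
  shows "quotient_sdepth n (mono_span A :: 'k::field mpoly set) \<le> enat (n - card X)"
  unfolding quotient_sdepth_def sdepth_def
proof (rule SUP_least)
  fix D :: "('k mpoly set \<times> nat set) list"
  assume "D \<in> {D. stanley_decomposition n (quotient_module (mpoly_ring n) (mono_span A)) (quotient_grading n (mono_span A)) D}"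
  then obtain L where L: "map snd L = map snd D" "monomial_partition n A L"
    using stanley_monomial_partition[OF A] by blast
  have "filter (\<lambda>(e, Z). b \<in> cell e Z) L \<noteq> []"
    using L(2) b unfolding monomial_partition_def by force
  then obtain e Z where eZ: "(e, Z) \<in> set L" "b \<in> cell e Z"
    by (auto simp: filter_empty_conv)
  then have Z: "Z \<subseteq> {1..n}" "cell e Z \<inter> A = {}"
    using L(2) by (auto simp: monomial_partition_def)
  have "i \<notin> Z" if "i \<in> X" for i
  proof
    assume "i \<in> Z"
    then have "b + single i 1 \<in> cell e Z"
      using eZ(2) by (auto simp: in_cell_iff lookup_add lookup_single when_def intro: le_SucI)
    then show False using bX[OF that] Z(2) by blast
  qed
  then have "Z \<subseteq> {1..n} - X" using Z(1) by blast
  then have "card Z \<le> card ({1..n} - X)" by (intro card_mono) simp_all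
  also have "\<dots> = n - card X" using X by (simp add: card_Diff_subset finite_subset)
  finally have "enat (card Z) \<le> enat (n - card X)" by simp
  moreover have "Z \<in> snd ` set D" using eZ(1) L(1) by (metis image_eqI list.set_map snd_conv)
  ultimately show "decomposition_sdepth D \<le> enat (n - card X)"
    unfolding decomposition_sdepth_def by (auto intro: INF_lower2)
qed

section \<open>Koszul cochains\<close>

text \<open>
  Cochains are functions on all lists of indices, not only on increasing ones. The differential
  and the contracting homotopy below then need no signs beyond the one in the recursion.
\<close>

fun koszul :: "(nat \<Rightarrow> 'r) \<Rightarrow> (nat list \<Rightarrow> 'r) \<Rightarrow> nat list \<Rightarrow> 'r::comm_ring_1" where
  "koszul x z [] = 0"
| "koszul x z (j # js) = x j * z js - koszul x (\<lambda>l. z (j # l)) js"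

lemma koszul_zero: "koszul x (\<lambda>l. 0) js = 0"
  by (induction js) simp_all

lemma koszul_add: "koszul x (\<lambda>l. y l + z l) js = koszul x y js + koszul x z js"
  by (induction js arbitrary: y z) (simp_all add: algebra_simps)

lemma koszul_cmult: "koszul x (\<lambda>l. c * z l) js = c * koszul x z js"
  by (induction js arbitrary: z) (simp_all add: algebra_simps)

lemma koszul_diff: "koszul x (\<lambda>l. y l - z l) js = koszul x y js - koszul x z js"
  by (induction js arbitrary: y z) (simp_all add: algebra_simps)

lemma koszul_sum: "koszul x (\<lambda>l. \<Sum>i\<in>I. f i l) js = (\<Sum>i\<in>I. koszul x (f i) js)"
  by (induction I rule: infinite_finite_induct) (simp_all add: koszul_zero koszul_add)

lemma koszul_koszul: "koszul x (koszul x z) js = 0"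
  by (induction js arbitrary: z) (simp_all add: koszul_diff koszul_cmult)

text \<open>The set \<open>N\<close> is kept abstract to serve both for ideals and, with
  \<open>N = {0}\<close>, for the congruence rule below.\<close>

lemma koszul_closed:
  assumes N: "0 \<in> N" "\<And>a b. a \<in> N \<Longrightarrow> b \<in> N \<Longrightarrow> a - b \<in> N" "\<And>j a. j \<in> J \<Longrightarrow> a \<in> N \<Longrightarrow> x j * a \<in> N"
    and "set js \<subseteq> J" "\<And>l. set l \<subseteq> J \<Longrightarrow> Suc (length l) = length js \<Longrightarrow> z l \<in> N"
  shows "koszul x z js \<in> N"
  using assms(4,5)
proof (induction js arbitrary: z)
  case Nil
  show ?case by (simp add: N(1))
next
  case (Cons j js)
  have "x j * z js \<in> N" using Cons.prems by (intro N(3)) simp_all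
  moreover have "koszul x (\<lambda>l. z (j # l)) js \<in> N"
    using Cons.prems by (intro Cons.IH) simp_all
  ultimately show ?case by (simp add: N(2))
qed

lemma koszul_cong:
  assumes "set js \<subseteq> J" "\<And>l. set l \<subseteq> J \<Longrightarrow> Suc (length l) = length js \<Longrightarrow> y l = z l"
  shows "koszul x y js = koszul x z js"
proof -
  have "koszul x (\<lambda>l. y l - z l) js \<in> {0}"
    using assms by (intro koszul_closed[where J = J]) simp_all
  then show ?thesis by (simp add: koszul_diff)
qed

lemma koszul_nonzero_sublist:
  assumes "koszul x z js \<noteq> 0"
  shows "\<exists>l. set l \<subseteq> set js \<and> z l \<noteq> 0"
proof (rule ccontr)
  assume "\<not> ?thesis"
  then have "koszul x z js = koszul x (\<lambda>l. 0) js"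
    by (intro koszul_cong[where J = "set js"]) auto
  then show False using assms by (simp add: koszul_zero)
qed

text \<open>Contraction with \<open>a\<close> is a null-homotopy of multiplication by the sum of the
  \<open>a j * x j\<close>. Prepending an index is exactly one unfolding of the recursion, so all
  other terms cancel.\<close>

lemma koszul_homotopy:
  "koszul x (\<lambda>l. \<Sum>j\<in>J. a j * z (j # l)) js + (\<Sum>j\<in>J. a j * koszul x z (j # js)) = (\<Sum>j\<in>J. a j * x j) * z js"
  by (simp add: koszul_sum koszul_cmult right_diff_distrib sum_subtractf sum_distrib_right mult.assoc)

section \<open>Koszul cohomology bounds the depth\<close>

lemma carrier_closed:
  fixes p q :: "'k::field mpoly"
  shows "p \<in> mono_span (exps Z) \<Longrightarrow> q \<in> mono_span (exps Z) \<Longrightarrow> p * q \<in> mono_span (exps Z)"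
  by (rule mono_span_mult[OF _ _ exps_add])

lemma mvar_closed: "j \<in> Z \<Longrightarrow> mvar j \<in> mono_span (exps Z)"
  unfolding mvar_eq_monom mono_span_monom_iff by (rule exps_single)

text \<open>Ideals of the ring in \<open>n\<close> variables, phrased with the operations of the
  type, in which the Koszul computations take place; \<open>poly_ideal_ideal\<close> makes the link
  to \<open>mpoly_ring n\<close>.\<close>

definition poly_ideal :: "nat \<Rightarrow> 'k::field mpoly set \<Rightarrow> bool"
  where "poly_ideal n N \<longleftrightarrow> N \<subseteq> mono_span (exps {1..n}) \<and> 0 \<in> N \<and> (\<forall>a\<in>N. \<forall>b\<in>N. a - b \<in> N) \<and>
    (\<forall>a\<in>N. \<forall>s\<in>mono_span (exps {1..n}). s * a \<in> N)"

definition add_multiples :: "nat \<Rightarrow> 'k::field mpoly set \<Rightarrow> 'k mpoly \<Rightarrow> 'k mpoly set"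
  where "add_multiples n N f = {a + f * s |a s. a \<in> N \<and> s \<in> mono_span (exps {1..n})}"

fun adjoin :: "nat \<Rightarrow> 'k::field mpoly set \<Rightarrow> 'k mpoly list \<Rightarrow> 'k mpoly set" where
  "adjoin n N [] = N"
| "adjoin n N (f # fs) = adjoin n (add_multiples n N f) fs"

text \<open>This is $H^i(S/N) \neq 0$ for the Koszul complex on lists; cochains are lifted to \<open>S\<close>.\<close>

definition cohomology_nonzero :: "nat \<Rightarrow> 'k::field mpoly set \<Rightarrow> nat \<Rightarrow> bool"
  where "cohomology_nonzero n N i \<longleftrightarrow>
    (\<exists>z. (\<forall>js. set js \<subseteq> {1..n} \<longrightarrow> z js \<in> mono_span (exps {1..n})) \<and>
      (\<forall>js. set js \<subseteq> {1..n} \<and> length js = Suc i \<longrightarrow> koszul mvar z js \<in> N) \<and>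
      \<not> (\<exists>u. (\<forall>js. set js \<subseteq> {1..n} \<longrightarrow> u js \<in> mono_span (exps {1..n})) \<and>
        (\<forall>js. set js \<subseteq> {1..n} \<and> length js = i \<longrightarrow> z js - koszul mvar u js \<in> N)))"

lemma cohomology_nonzeroI:
  assumes "\<And>js. set js \<subseteq> {1..n} \<Longrightarrow> z js \<in> mono_span (exps {1..n})"
    and "\<And>js. set js \<subseteq> {1..n} \<Longrightarrow> length js = Suc i \<Longrightarrow> koszul mvar z js \<in> N"
    and "\<And>u. (\<And>js. set js \<subseteq> {1..n} \<Longrightarrow> u js \<in> mono_span (exps {1..n})) \<Longrightarrow>
      (\<And>js. set js \<subseteq> {1..n} \<Longrightarrow> length js = i \<Longrightarrow> z js - koszul mvar u js \<in> N) \<Longrightarrow> False"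
  shows "cohomology_nonzero n N i"
  unfolding cohomology_nonzero_def
proof (intro exI[of _ z] conjI allI impI notI; (elim exE conjE)?)
  fix u assume "\<forall>js. set js \<subseteq> {1..n} \<longrightarrow> u js \<in> mono_span (exps {1..n})"
    "\<forall>js. set js \<subseteq> {1..n} \<and> length js = i \<longrightarrow> z js - koszul mvar u js \<in> N"
  then show False by (intro assms(3)[of u]) simp_all
qed (use assms in simp_all)

lemma cohomology_nonzeroE:
  assumes "cohomology_nonzero n N i"
  obtains z where "\<And>js. set js \<subseteq> {1..n} \<Longrightarrow> z js \<in> mono_span (exps {1..n})"
    and "\<And>js. set js \<subseteq> {1..n} \<Longrightarrow> length js = Suc i \<Longrightarrow> koszul mvar z js \<in> N"
    and "\<And>u. (\<And>js. set js \<subseteq> {1..n} \<Longrightarrow> u js \<in> mono_span (exps {1..n})) \<Longrightarrow>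
      (\<And>js. set js \<subseteq> {1..n} \<Longrightarrow> length js = i \<Longrightarrow> z js - koszul mvar u js \<in> N) \<Longrightarrow> False"
proof -
  obtain z where z: "\<forall>js. set js \<subseteq> {1..n} \<longrightarrow> z js \<in> mono_span (exps {1..n})"
    "\<forall>js. set js \<subseteq> {1..n} \<and> length js = Suc i \<longrightarrow> koszul mvar z js \<in> N"
    and nb: "\<not> (\<exists>u. (\<forall>js. set js \<subseteq> {1..n} \<longrightarrow> u js \<in> mono_span (exps {1..n})) \<and>
        (\<forall>js. set js \<subseteq> {1..n} \<and> length js = i \<longrightarrow> z js - koszul mvar u js \<in> N))"
    using assms unfolding cohomology_nonzero_def by (elim exE conjE)
  show ?thesis
  proof (rule that[of z])
    fix u assume u: "\<And>js. set js \<subseteq> {1..n} \<Longrightarrow> u js \<in> mono_span (exps {1..n})"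
      "\<And>js. set js \<subseteq> {1..n} \<Longrightarrow> length js = i \<Longrightarrow> z js - koszul mvar u js \<in> N"
    show False by (rule notE[OF nb], intro exI[of _ u] conjI allI impI) (use u in simp_all)
  qed (use z in simp_all)
qed

lemma poly_idealD:
  assumes "poly_ideal n N"
  shows "N \<subseteq> mono_span (exps {1..n})" "0 \<in> N" "a \<in> N \<Longrightarrow> b \<in> N \<Longrightarrow> a - b \<in> N"
    "a \<in> N \<Longrightarrow> b \<in> N \<Longrightarrow> a + b \<in> N" "a \<in> N \<Longrightarrow> s \<in> mono_span (exps {1..n}) \<Longrightarrow> s * a \<in> N"
proof -
  show *: "0 \<in> N" "a \<in> N \<Longrightarrow> b \<in> N \<Longrightarrow> a - b \<in> N" for a b
    using assms by (simp_all add: poly_ideal_def)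
  show "a \<in> N \<Longrightarrow> b \<in> N \<Longrightarrow> a + b \<in> N"
    using *(2)[OF _ *(2)[OF *(1)], of a b] by simp
qed (use assms in \<open>simp_all add: poly_ideal_def\<close>)

lemma poly_ideal_sum:
  assumes "poly_ideal n N" "\<And>i. i \<in> I \<Longrightarrow> f i \<in> N"
  shows "sum f I \<in> N"
  using assms(2) by (induction I rule: infinite_finite_induct) (simp_all add: poly_idealD[OF assms(1)])

lemma poly_ideal_top: "poly_ideal n (mono_span (exps {1..n}))"
  by (simp add: poly_ideal_def mono_span_diff carrier_closed)

lemma koszul_in_poly_ideal:
  assumes N: "poly_ideal n N" and "set js \<subseteq> {1..n}"
    and "\<And>l. set l \<subseteq> {1..n} \<Longrightarrow> Suc (length l) = length js \<Longrightarrow> z l \<in> N"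
  shows "koszul mvar z js \<in> N"
proof (rule koszul_closed[OF poly_idealD(2,3)[OF N] _ assms(2,3)])
  fix j a assume "j \<in> {1..n}" "a \<in> N"
  then show "mvar j * a \<in> N" by (intro poly_idealD(5)[OF N] mvar_closed)
qed

lemma poly_ideal_add_multiples:
  assumes N: "poly_ideal n N" and f: "f \<in> mono_span (exps {1..n})"
  shows "poly_ideal n (add_multiples n N f)"
  unfolding poly_ideal_def
proof (intro conjI ballI subsetI)
  show "0 \<in> add_multiples n N f"
    using poly_idealD(2)[OF N] unfolding add_multiples_def by (intro CollectI exI[of _ 0]) simp
  show "p \<in> mono_span (exps {1..n})" if "p \<in> add_multiples n N f" for p
    using that poly_idealD(1)[OF N] f unfolding add_multiples_def
    by (auto intro!: mono_span_add carrier_closed)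
  show "p - q \<in> add_multiples n N f" if pq: "p \<in> add_multiples n N f" "q \<in> add_multiples n N f" for p q
  proof -
    obtain a s b t where "p = a + f * s" "q = b + f * t" "a \<in> N" "b \<in> N"
      "s \<in> mono_span (exps {1..n})" "t \<in> mono_span (exps {1..n})"
      using pq unfolding add_multiples_def by blast
    moreover from this have "p - q = (a - b) + f * (s - t)" by (simp add: algebra_simps)
    ultimately show ?thesis
      unfolding add_multiples_def using poly_idealD(3)[OF N, of a b] mono_span_diff[of s _ t] by blast
  qed
  show "r * p \<in> add_multiples n N f" if pr: "p \<in> add_multiples n N f" "r \<in> mono_span (exps {1..n})" for p r
  proof -
    obtain a s where "p = a + f * s" "a \<in> N" "s \<in> mono_span (exps {1..n})"
      using pr unfolding add_multiples_def by blast
    moreover from this have "r * p = r * a + f * (r * s)" by (simp add: algebra_simps)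
    ultimately show ?thesis
      unfolding add_multiples_def using pr(2) poly_idealD(5)[OF N, of a r] carrier_closed[of r _ s] by blast
  qed
qed

text \<open>
  The map \<open>z \<mapsto> y\<close> of the proof inverts the connecting homomorphism
  $H^i(S/(N + fS)) \rightarrow H^{i+1}(S/N)$, which is surjective as \<open>f\<close> is homotopic to zero.
\<close>

lemma cohomology_nonzero_add_multiples:
  fixes N :: "'k::field mpoly set"
  assumes N: "poly_ideal n N" and z: "cohomology_nonzero n N (Suc i)"
    and f: "f = (\<Sum>j\<in>{1..n}. a j * mvar j)" "\<And>j. j \<in> {1..n} \<Longrightarrow> a j \<in> mono_span (exps {1..n})"
    and reg: "\<And>g. g \<in> mono_span (exps {1..n}) \<Longrightarrow> f * g \<in> N \<Longrightarrow> g \<in> N"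
  shows "cohomology_nonzero n (add_multiples n N f) i"
proof -
  let ?S = "mono_span (exps {1..n}) :: 'k mpoly set"
  obtain z where zS: "\<And>js. set js \<subseteq> {1..n} \<Longrightarrow> z js \<in> ?S"
    and zN: "\<And>js. set js \<subseteq> {1..n} \<Longrightarrow> length js = Suc (Suc i) \<Longrightarrow> koszul mvar z js \<in> N"
    and nb: "\<And>u. (\<And>js. set js \<subseteq> {1..n} \<Longrightarrow> u js \<in> ?S) \<Longrightarrow>
      (\<And>js. set js \<subseteq> {1..n} \<Longrightarrow> length js = Suc i \<Longrightarrow> z js - koszul mvar u js \<in> N) \<Longrightarrow> False"
  proof (rule cohomology_nonzeroE[OF z], goal_cases)
    case (1 z)
    show ?case by (rule 1(1); fact 1)
  qed
  define y where "y l = (\<Sum>j\<in>{1..n}. a j * z (j # l))" for l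
  have yS: "y js \<in> ?S" if "set js \<subseteq> {1..n}" for js
    unfolding y_def using that by (intro mono_span_sum carrier_closed f(2) zS) simp_all
  have yk: "\<exists>b\<in>N. koszul mvar y js + b = f * z js" if "set js \<subseteq> {1..n}" "length js = Suc i" for js
  proof
    show "koszul mvar y js + (\<Sum>j\<in>{1..n}. a j * koszul mvar z (j # js)) = f * z js"
      unfolding y_def f(1) by (rule koszul_homotopy)
    show "(\<Sum>j\<in>{1..n}. a j * koszul mvar z (j # js)) \<in> N"
      using that by (intro poly_ideal_sum[OF N] poly_idealD(5)[OF N] zN f(2)) simp_all
  qed
  have yN: "koszul mvar y js \<in> add_multiples n N f" if js: "set js \<subseteq> {1..n}" "length js = Suc i" for js
  proof -
    obtain b where b: "b \<in> N" "koszul mvar y js + b = f * z js" using yk[OF js] by blast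
    have "koszul mvar y js = (0 - b) + f * z js"
      using b(2) by (simp add: algebra_simps)
    moreover have "0 - b \<in> N" by (rule poly_idealD(3)[OF N poly_idealD(2)[OF N] b(1)])
    ultimately show ?thesis unfolding add_multiples_def using zS[OF js(1)] by blast
  qed
  have nbound: False if uS: "\<And>js. set js \<subseteq> {1..n} \<Longrightarrow> u js \<in> ?S"
    and u: "\<And>js. set js \<subseteq> {1..n} \<Longrightarrow> length js = i \<Longrightarrow> y js - koszul mvar u js \<in> add_multiples n N f" for u
  proof -
    have "\<forall>js. \<exists>s. set js \<subseteq> {1..n} \<longrightarrow> s \<in> ?S \<and> (length js = i \<longrightarrow> y js - koszul mvar u js - f * s \<in> N)"
    proof
      fix js
      show "\<exists>s. set js \<subseteq> {1..n} \<longrightarrow> s \<in> ?S \<and> (length js = i \<longrightarrow> y js - koszul mvar u js - f * s \<in> N)"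
      proof (cases "set js \<subseteq> {1..n} \<and> length js = i")
        case True
        then obtain b s where "b \<in> N" "s \<in> ?S" "y js - koszul mvar u js = b + f * s"
          using u[of js] unfolding add_multiples_def by blast
        then show ?thesis by (intro exI[of _ s]) simp
      next
        case False
        then show ?thesis by (intro exI[of _ 0]) auto
      qed
    qed
    then obtain s where s: "\<And>js. set js \<subseteq> {1..n} \<Longrightarrow> s js \<in> ?S"
      "\<And>js. set js \<subseteq> {1..n} \<Longrightarrow> length js = i \<Longrightarrow> y js - koszul mvar u js - f * s js \<in> N"
      by metis
    have "z js - koszul mvar s js \<in> N" if js: "set js \<subseteq> {1..n}" "length js = Suc i" for js
    proof -
      \<comment> \<open>If \<open>y\<close> bounds modulo \<open>N + f S\<close>, write the error as
        \<open>f * s\<close>. The differential removes \<open>u\<close>, and comparison with the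
        homotopy formula puts \<open>f * (z js - koszul mvar s js)\<close> into \<open>N\<close>;
        regularity of \<open>f\<close> then makes \<open>z\<close> a coboundary modulo
        \<open>N\<close>.\<close>
      have "koszul mvar (\<lambda>l. y l - koszul mvar u l - f * s l) js \<in> N"
        using js by (intro koszul_in_poly_ideal[OF N] s(2)) simp_all
      then have 1: "koszul mvar y js - f * koszul mvar s js \<in> N"
        by (simp add: koszul_diff koszul_koszul koszul_cmult)
      obtain b where b: "b \<in> N" "koszul mvar y js + b = f * z js" using yk[OF js] by blast
      have "f * (z js - koszul mvar s js) = (koszul mvar y js - f * koszul mvar s js) + b"
        using b(2) by (simp add: algebra_simps)
      then have "f * (z js - koszul mvar s js) \<in> N"
        using poly_idealD(4)[OF N 1 b(1)] by simp
      moreover have "koszul mvar s js \<in> ?S"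
        using js by (intro koszul_in_poly_ideal[OF poly_ideal_top] s(1)) simp_all
      ultimately show ?thesis by (rule reg[OF mono_span_diff[OF zS[OF js(1)]], rotated])
    qed
    note zs = this
    show False by (rule nb[of s]; fact s(1) zs)
  qed
  show ?thesis by (rule cohomology_nonzeroI[of n y]; fact yS yN nbound)
qed

text \<open>Each element of a regular sequence lowers the degree of a nonzero cohomology class by
  one. In degree 0 no further element fits: there a class is an element \<open>z []\<close> outside
  \<open>N\<close> that all variables carry into \<open>N\<close>, and then so does every
  combination \<open>f\<close> of the variables, against its regularity.\<close>

lemma regular_length_le:
  fixes N :: "'k::field mpoly set"
  assumes "poly_ideal n N" "cohomology_nonzero n N i"
    and "\<And>f. f \<in> set fs \<Longrightarrow> \<exists>a. f = (\<Sum>j\<in>{1..n}. a j * mvar j) \<and> (\<forall>j\<in>{1..n}. a j \<in> mono_span (exps {1..n}))"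
    and "\<And>k g. k < length fs \<Longrightarrow> g \<in> mono_span (exps {1..n}) \<Longrightarrow> (fs ! k) * g \<in> adjoin n N (take k fs) \<Longrightarrow>
      g \<in> adjoin n N (take k fs)"
  shows "length fs \<le> i"
  using assms
proof (induction fs arbitrary: N i)
  case (Cons f fs)
  let ?S = "mono_span (exps {1..n}) :: 'k mpoly set"
  obtain a where f: "f = (\<Sum>j\<in>{1..n}. a j * mvar j)" and a: "\<And>j. j \<in> {1..n} \<Longrightarrow> a j \<in> ?S"
    using Cons.prems(3)[of f] by auto
  have reg: "g \<in> N" if "g \<in> ?S" "f * g \<in> N" for g
    using Cons.prems(4)[of 0 g] that by simp
  have fS: "f \<in> ?S"
    unfolding f by (intro mono_span_sum carrier_closed a mvar_closed)
  show ?case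
  proof (cases i)
    case 0
    obtain z where z: "\<And>js. set js \<subseteq> {1..n} \<Longrightarrow> z js \<in> ?S"
        "\<And>js. set js \<subseteq> {1..n} \<Longrightarrow> length js = Suc 0 \<Longrightarrow> koszul mvar z js \<in> N"
      and nb: "\<And>u. (\<And>js. set js \<subseteq> {1..n} \<Longrightarrow> u js \<in> ?S) \<Longrightarrow>
        (\<And>js. set js \<subseteq> {1..n} \<Longrightarrow> length js = 0 \<Longrightarrow> z js - koszul mvar u js \<in> N) \<Longrightarrow> False"
    proof (rule cohomology_nonzeroE[OF Cons.prems(2)[unfolded 0]], goal_cases)
      case (1 z)
      show ?case by (rule 1(1); fact 1)
    qed
    have "mvar j * z [] \<in> N" if "j \<in> {1..n}" for j
      using z(2)[of "[j]"] that by simp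
    then have "a j * (mvar j * z []) \<in> N" if "j \<in> {1..n}" for j
      by (rule poly_idealD(5)[OF Cons.prems(1) _ a]) (fact that)+
    then have "(\<Sum>j\<in>{1..n}. a j * (mvar j * z [])) \<in> N"
      by (rule poly_ideal_sum[OF Cons.prems(1)])
    then have "f * z [] \<in> N"
      by (simp add: f sum_distrib_right mult.assoc)
    then have "z [] \<in> N" using reg[of "z []"] z(1)[of "[]"] by simp
    then show ?thesis using nb[of "\<lambda>_. 0"] by simp
  next
    case (Suc i')
    have "length fs \<le> i'"
    proof (rule Cons.IH)
      show "poly_ideal n (add_multiples n N f)"
        by (rule poly_ideal_add_multiples[OF Cons.prems(1) fS])
      show "cohomology_nonzero n (add_multiples n N f) i'"
        by (rule cohomology_nonzero_add_multiples[OF Cons.prems(1) Cons.prems(2)[unfolded Suc] f a reg])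
      show "\<exists>a. g = (\<Sum>j\<in>{1..n}. a j * mvar j) \<and> (\<forall>j\<in>{1..n}. a j \<in> ?S)" if "g \<in> set fs" for g
        using Cons.prems(3)[of g] that by simp
      show "g \<in> adjoin n (add_multiples n N f) (take k fs)"
        if "k < length fs" "g \<in> ?S" "fs ! k * g \<in> adjoin n (add_multiples n N f) (take k fs)" for k g
        using Cons.prems(4)[of "Suc k" g] that by simp
    qed
    then show ?thesis using Suc by simp
  qed
qed simp

section \<open>From ideals of the polynomial ring to regular sequences on \<open>S/I\<close>\<close>

lemma adjoin_eq:
  "adjoin n N fs = {a + (\<Sum>i<length fs. fs ! i * g i) |a g. a \<in> N \<and> (\<forall>i<length fs. g i \<in> mono_span (exps {1..n}))}"
proof (induction fs arbitrary: N)
  case (Cons f fs)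
  let ?S = "mono_span (exps {1..n})"
  show ?case
  proof (intro equalityI subsetI)
    fix p assume "p \<in> adjoin n N (f # fs)"
    then obtain a s g where p: "p = a + f * s + (\<Sum>i<length fs. fs ! i * g i)"
      and as: "a \<in> N" "s \<in> ?S" "\<forall>i<length fs. g i \<in> ?S"
      by (auto simp: Cons.IH add_multiples_def)
    define g' where "g' = case_nat s g"
    have "p = a + (\<Sum>i<length (f # fs). (f # fs) ! i * g' i)"
      by (simp add: p g'_def sum.lessThan_Suc_shift del: sum.lessThan_Suc)
    moreover have "\<forall>i<length (f # fs). g' i \<in> ?S"
      using as by (auto simp: g'_def split: nat.split)
    ultimately show "p \<in> {a + (\<Sum>i<length (f # fs). (f # fs) ! i * g i) |a g. a \<in> N \<and> (\<forall>i<length (f # fs). g i \<in> ?S)}"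
      using as(1) by blast
  next
    fix p assume "p \<in> {a + (\<Sum>i<length (f # fs). (f # fs) ! i * g i) |a g. a \<in> N \<and> (\<forall>i<length (f # fs). g i \<in> ?S)}"
    then obtain a g where p: "p = a + (\<Sum>i<length (f # fs). (f # fs) ! i * g i)" "a \<in> N"
      "\<forall>i<length (f # fs). g i \<in> ?S" by blast
    have "p = (a + f * g 0) + (\<Sum>i<length fs. fs ! i * g (Suc i))"
      by (simp add: p(1) sum.lessThan_Suc_shift add.assoc del: sum.lessThan_Suc)
    moreover have "a + f * g 0 \<in> add_multiples n N f"
      using p by (auto simp: add_multiples_def)
    moreover have "\<forall>i<length fs. g (Suc i) \<in> ?S" using p(3) by simp
    ultimately show "p \<in> adjoin n N (f # fs)"
      unfolding adjoin.simps Cons.IH by (intro CollectI exI[of _ "a + f * g 0"] exI[of _ "\<lambda>i. g (Suc i)"] conjI)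
  qed
qed simp

lemma coset_mem_list_smult_module_iff:
  fixes I :: "'k::field mpoly set"
  assumes I: "ideal I (mpoly_ring n)" and p: "p \<in> mono_span (exps {1..n})"
    and fs: "set fs \<subseteq> mono_span (exps {1..n})"
  shows "I +>\<^bsub>mpoly_ring n\<^esub> p \<in> list_smult_module (quotient_module (mpoly_ring n) I) fs \<longleftrightarrow> p \<in> adjoin n I fs"
    (is "?cl p \<in> list_smult_module ?M fs \<longleftrightarrow> _")
proof -
  interpret M: abelian_group ?M by (rule abelian_group_quotient_module[OF I])
  let ?S = "mono_span (exps {1..n}) :: 'k mpoly set"
  have fsi: "fs ! i \<in> ?S" if "i < length fs" for i
    using fs that by auto
  have mult: "fs ! i * s \<in> ?S" if "i < length fs" "s \<in> ?S" for i s
    using fsi that by (intro carrier_closed)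
  have eq: "(\<Oplus>\<^bsub>?M\<^esub>i\<in>{..<length fs}. (fs ! i) \<odot>\<^bsub>?M\<^esub> u i) = ?cl (\<Sum>i<length fs. fs ! i * g i)"
    if u: "\<And>i. i < length fs \<Longrightarrow> g i \<in> ?S \<and> u i = ?cl (g i)" for u g
  proof -
    have "(\<Oplus>\<^bsub>?M\<^esub>i\<in>{..<length fs}. (fs ! i) \<odot>\<^bsub>?M\<^esub> u i) = (\<Oplus>\<^bsub>?M\<^esub>i\<in>{..<length fs}. ?cl (fs ! i * g i))"
    proof (rule M.finsum_cong'[OF refl])
      show "(\<lambda>i. ?cl (fs ! i * g i)) \<in> {..<length fs} \<rightarrow> carrier ?M"
        using mult u by (auto simp: carrier_quotient_module carrier_mpoly_ring)
      fix i assume "i \<in> {..<length fs}"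
      then show "(fs ! i) \<odot>\<^bsub>?M\<^esub> u i = ?cl (fs ! i * g i)"
        using u[of i] fsi[of i] smult_quotient_module[OF I, of "fs ! i" "g i"] by (simp add: carrier_mpoly_ring)
    qed
    also have "\<dots> = ?cl (\<Sum>i<length fs. fs ! i * g i)"
      using mult u by (intro finsum_quotient_module[OF I]) (simp_all add: carrier_mpoly_ring)
    finally show ?thesis .
  qed
  have sumS: "(\<Sum>i<length fs. fs ! i * g i) \<in> ?S" if "\<forall>i<length fs. g i \<in> ?S" for g
    using that mult by (intro mono_span_sum) simp
  show ?thesis
  proof
    assume "?cl p \<in> list_smult_module ?M fs"
    then obtain u where u: "u \<in> {..<length fs} \<rightarrow> carrier ?M"
      and p': "?cl p = (\<Oplus>\<^bsub>?M\<^esub>i\<in>{..<length fs}. (fs ! i) \<odot>\<^bsub>?M\<^esub> u i)"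
      unfolding list_smult_module_def by blast
    have "\<forall>i. \<exists>g. i < length fs \<longrightarrow> g \<in> ?S \<and> u i = ?cl g"
    proof
      fix i
      have "i < length fs \<Longrightarrow> u i \<in> ?cl ` ?S"
        using u by (auto simp: carrier_quotient_module carrier_mpoly_ring)
      then show "\<exists>g. i < length fs \<longrightarrow> g \<in> ?S \<and> u i = ?cl g" by blast
    qed
    then obtain g where g: "\<And>i. i < length fs \<Longrightarrow> g i \<in> ?S \<and> u i = ?cl (g i)"
      by metis
    then have "?cl p = ?cl (\<Sum>i<length fs. fs ! i * g i)" using p' eq by simp
    moreover have "(\<Sum>i<length fs. fs ! i * g i) \<in> ?S" using g sumS by blast
    ultimately have "p - (\<Sum>i<length fs. fs ! i * g i) \<in> I"
      using coset_eq_iff[OF I] p by (simp add: carrier_mpoly_ring)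
    moreover have "p = (p - (\<Sum>i<length fs. fs ! i * g i)) + (\<Sum>i<length fs. fs ! i * g i)" by simp
    ultimately show "p \<in> adjoin n I fs" unfolding adjoin_eq using g by blast
  next
    assume "p \<in> adjoin n I fs"
    then obtain b g where b: "p = b + (\<Sum>i<length fs. fs ! i * g i)" "b \<in> I" and g: "\<forall>i<length fs. g i \<in> ?S"
      unfolding adjoin_eq by blast
    have "?cl p = ?cl (\<Sum>i<length fs. fs ! i * g i)"
      using coset_eq_iff[OF I, of p "\<Sum>i<length fs. fs ! i * g i"] p sumS[OF g] b
      by (simp add: carrier_mpoly_ring)
    also have "\<dots> = (\<Oplus>\<^bsub>?M\<^esub>i\<in>{..<length fs}. (fs ! i) \<odot>\<^bsub>?M\<^esub> ?cl (g i))"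
      using g by (intro eq[symmetric]) simp
    finally have "?cl p = (\<Oplus>\<^bsub>?M\<^esub>i\<in>{..<length fs}. (fs ! i) \<odot>\<^bsub>?M\<^esub> ?cl (g i))" .
    moreover have "(\<lambda>i. ?cl (g i)) \<in> {..<length fs} \<rightarrow> carrier ?M"
      using g by (auto simp: carrier_quotient_module carrier_mpoly_ring)
    ultimately show "?cl p \<in> list_smult_module ?M fs"
      unfolding list_smult_module_def by (intro CollectI exI[of _ "\<lambda>i. ?cl (g i)"] conjI)
  qed
qed

lemma poly_ideal_ideal:
  assumes "ideal I (mpoly_ring n)"
  shows "poly_ideal n I"
proof -
  interpret ideal I "mpoly_ring n" by fact
  have sub: "I \<subseteq> carrier (mpoly_ring n)" by (rule a_subset)
  have "a - b \<in> I" if "a \<in> I" "b \<in> I" for a b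
  proof -
    have "- 1 \<in> carrier (mpoly_ring n)"
      unfolding carrier_mpoly_ring by (rule mono_span_uminus) (simp add: mono_span_monom_iff flip: monom_zero)
    from I_l_closed[OF that(2) this] have "- b \<in> I"
      by (simp add: mpoly_ring_simps)
    from additive_subgroup.a_closed[OF is_additive_subgroup that(1) this] show ?thesis
      by (simp only: mpoly_ring_simps add_uminus_conv_diff)
  qed
  moreover have "0 \<in> I"
    using additive_subgroup.zero_closed[OF is_additive_subgroup] by (simp add: mpoly_ring_simps)
  moreover have "s * a \<in> I" if "a \<in> I" "s \<in> mono_span (exps {1..n})" for s a
    using I_l_closed[of a s] that by (simp add: mpoly_ring_simps carrier_mpoly_ring)
  ultimately show ?thesis
    unfolding poly_ideal_def using sub by (simp add: carrier_mpoly_ring)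
qed

text \<open>Each exponent \<open>b\<close> in the support is assigned one variable
  \<open>v b\<close> dividing it; \<open>a j\<close> collects the terms assigned to
  \<open>j\<close>, divided by that variable. This is the form of \<open>f\<close> that the
  contracting homotopy needs.\<close>

lemma max_ideal_combination:
  fixes f :: "'k::field mpoly"
  assumes "f \<in> max_ideal n"
  shows "\<exists>a. f = (\<Sum>j\<in>{1..n}. a j * mvar j) \<and> (\<forall>j\<in>{1..n}. a j \<in> mono_span (exps {1..n}))"
proof -
  let ?B = "(\<lambda>i. single i 1) ` {1..n} :: (nat \<Rightarrow>\<^sub>0 nat) set"
  have B: "?B \<subseteq> exps {1..n}" by (auto intro!: exps_single)
  have "(max_ideal n :: 'k mpoly set) = Idl\<^bsub>mpoly_ring n\<^esub> (monom ` ?B)"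
    unfolding max_ideal_def image_image mvar_eq_monom ..
  then have f: "f \<in> mono_span {b + c |b c. b \<in> ?B \<and> c \<in> exps {1..n}}"
    using assms unfolding genideal_monomials[OF B] by (rule subst)
  have "\<forall>b. \<exists>j. b \<in> keys f \<longrightarrow> j \<in> {1..n} \<and> (\<exists>c\<in>exps {1..n}. b = single j 1 + c)"
  proof
    fix b
    have "b \<in> keys f \<Longrightarrow> \<exists>j. j \<in> {1..n} \<and> (\<exists>c\<in>exps {1..n}. b = single j 1 + c)"
      using f unfolding mono_span_def by blast
    then show "\<exists>j. b \<in> keys f \<longrightarrow> j \<in> {1..n} \<and> (\<exists>c\<in>exps {1..n}. b = single j 1 + c)" by blast
  qed
  then obtain v where v: "\<And>b. b \<in> keys f \<Longrightarrow> v b \<in> {1..n} \<and> (\<exists>c\<in>exps {1..n}. b = single (v b) 1 + c)"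
    by metis
  define a where "a j = (\<Sum>b\<in>{b \<in> keys f. v b = j}. single (b - single j 1) (lookup f b))" for j
  have split: "b = single (v b) 1 + (b - single (v b) 1)" "b - single (v b) 1 \<in> exps {1..n}"
    if b: "b \<in> keys f" for b
  proof -
    obtain c where "c \<in> exps {1..n}" and c: "b = single (v b) 1 + c" using v[OF b] by blast
    moreover have "b - single (v b) 1 = c" by (subst c) (rule add_diff_cancel_left')
    ultimately show "b = single (v b) 1 + (b - single (v b) 1)" "b - single (v b) 1 \<in> exps {1..n}" by simp_all
  qed
  have "a j \<in> mono_span (exps {1..n})" for j
    unfolding a_def using split(2) by (intro mono_span_sum mono_span_single) auto
  moreover have "(\<Sum>j\<in>{1..n}. a j * mvar j) = f"
  proof -
    have "a j * mvar j = (\<Sum>b\<in>{b \<in> keys f. v b = j}. single b (lookup f b))" for j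
      unfolding a_def sum_distrib_right mvar_def
    proof (rule sum.cong[OF refl])
      fix b assume b: "b \<in> {b \<in> keys f. v b = j}"
      then have "b - single j 1 + single j 1 = b" using split(1)[of b] by (simp add: add.commute)
      then show "single (b - single j 1) (lookup f b) * single (single j 1) 1 = single b (lookup f b)"
        by (simp add: mult_single)
    qed
    then have "(\<Sum>j\<in>{1..n}. a j * mvar j) = (\<Sum>j\<in>{1..n}. \<Sum>b\<in>{b \<in> keys f. v b = j}. single b (lookup f b))"
      by simp
    also have "\<dots> = (\<Sum>b\<in>keys f. single b (lookup f b))"
      using v by (intro sum.group) auto
    finally show ?thesis by (simp add: sum_singles)
  qed
  ultimately show ?thesis by metis
qed

lemma quotient_depth_le:
  fixes I :: "'k::field mpoly set"
  assumes I: "ideal I (mpoly_ring n)" and coh: "cohomology_nonzero n I i"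
  shows "quotient_depth n I \<le> enat i"
  unfolding quotient_depth_def depth_def
proof (rule SUP_least)
  let ?M = "quotient_module (mpoly_ring n) I"
  fix fs :: "'k mpoly list"
  assume "fs \<in> {fs. set fs \<subseteq> max_ideal n \<and> regular_sequence (mpoly_ring n) ?M fs}"
  then have m: "set fs \<subseteq> max_ideal n" and carr: "set fs \<subseteq> mono_span (exps {1..n})"
    and reg: "\<And>k v. k < length fs \<Longrightarrow> v \<in> carrier ?M \<Longrightarrow> (fs ! k) \<odot>\<^bsub>?M\<^esub> v \<in> list_smult_module ?M (take k fs) \<Longrightarrow>
      v \<in> list_smult_module ?M (take k fs)"
    by (simp_all add: regular_sequence_def carrier_mpoly_ring)
  have "length fs \<le> i"
  proof (rule regular_length_le[OF poly_ideal_ideal[OF I] coh])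
    fix f assume "f \<in> set fs"
    then show "\<exists>a. f = (\<Sum>j\<in>{1..n}. a j * mvar j) \<and> (\<forall>j\<in>{1..n}. a j \<in> mono_span (exps {1..n}))"
      using m by (intro max_ideal_combination) blast
  next
    fix k g assume k: "k < length fs" and g: "g \<in> mono_span (exps {1..n})"
      and fg: "fs ! k * g \<in> adjoin n I (take k fs)"
    have tk: "set (take k fs) \<subseteq> mono_span (exps {1..n})" using carr set_take_subset[of k fs] by blast
    have fk: "fs ! k \<in> mono_span (exps {1..n})" using carr k by auto
    have "(fs ! k) \<odot>\<^bsub>?M\<^esub> (I +>\<^bsub>mpoly_ring n\<^esub> g) \<in> list_smult_module ?M (take k fs)"
      using coset_mem_list_smult_module_iff[OF I carrier_closed[OF fk g] tk] fg
        smult_quotient_module[OF I, of "fs ! k" g] fk g by (simp add: carrier_mpoly_ring)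
    moreover have "I +>\<^bsub>mpoly_ring n\<^esub> g \<in> carrier ?M"
      unfolding carrier_quotient_module carrier_mpoly_ring using g by (rule imageI)
    ultimately have "I +>\<^bsub>mpoly_ring n\<^esub> g \<in> list_smult_module ?M (take k fs)"
      using reg[OF k] by blast
    then show "g \<in> adjoin n I (take k fs)"
      using coset_mem_list_smult_module_iff[OF I g tk] by simp
  qed
  then show "enat (length fs) \<le> enat i" by simp
qed

section \<open>A nonzero class for the transversals\<close>

text \<open>
  The classes modulo \<open>d\<close> are the vertices of a simplex. \<open>simplex_cocycle k\<close> represents the generator
  of $H^{k-1}$ of the boundary of the simplex with vertices \<open>0, \<dots>, k\<close>: it is the coboundary of the
  previous one, computed in the full simplex and extended by zero.
\<close>

fun simplex_cocycle :: "nat \<Rightarrow> nat list \<Rightarrow> 'k::comm_ring_1" where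
  "simplex_cocycle 0 js = (if js = [] then 1 else 0)"
| "simplex_cocycle (Suc k) js = (if set js \<subseteq> {..k} then koszul (\<lambda>_. 1) (simplex_cocycle k) js else 0)"

text \<open>Terms of the differential come from sublists, which gives the vertices below
  \<open>k\<close> by induction. If the vertex \<open>k\<close> were missing as well, the list would
  lie in the smaller simplex, where \<open>simplex_cocycle k\<close> is itself a coboundary, and the
  differential would vanish.\<close>

lemma simplex_cocycle_support:
  "simplex_cocycle k js \<noteq> (0 :: 'k::comm_ring_1) \<Longrightarrow> set js = {..<k}"
  "set js \<subseteq> {..k} \<Longrightarrow> koszul (\<lambda>_. 1) (simplex_cocycle k) js \<noteq> (0 :: 'k) \<Longrightarrow> {..k} \<subseteq> set js"
proof -
  have step: "{..k} \<subseteq> set js"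
    if supp: "\<And>l. simplex_cocycle k l \<noteq> (0 :: 'k) \<Longrightarrow> set l = {..<k}"
      and js: "set js \<subseteq> {..k}" and nz: "koszul (\<lambda>_. 1) (simplex_cocycle k) js \<noteq> (0 :: 'k)" for k js
  proof -
    have "{..<k} \<subseteq> set js"
      using koszul_nonzero_sublist[OF nz] supp by metis
    moreover have "k \<in> set js"
    proof (rule ccontr)
      assume k: "k \<notin> set js"
      then have js: "set js \<subseteq> {..<k}" using js by (auto simp: le_less)
      show False
      proof (cases k)
        case 0
        then show False using js nz by simp
      next
        case (Suc k')
        have "koszul (\<lambda>_. 1) (simplex_cocycle k) js = koszul (\<lambda>_. 1) (koszul (\<lambda>_. 1 :: 'k) (simplex_cocycle k')) js"
          using js Suc by (intro koszul_cong[where J = "{..k'}"]) (auto simp: lessThan_Suc_atMost)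
        then show False using nz by (simp add: koszul_koszul)
      qed
    qed
    ultimately show ?thesis by (auto simp: le_less)
  qed
  have supp: "set js = {..<k}" if "simplex_cocycle k js \<noteq> (0 :: 'k)" for k js
    using that
  proof (induction k arbitrary: js)
    case 0
    then show ?case by (simp split: if_splits)
  next
    case (Suc k)
    then have "set js \<subseteq> {..k}" "koszul (\<lambda>_. 1) (simplex_cocycle k) js \<noteq> (0 :: 'k)"
      by (simp_all split: if_splits)
    then show ?case using step[OF Suc.IH] by (simp add: lessThan_Suc_atMost subset_antisym)
  qed
  show "simplex_cocycle k js \<noteq> (0 :: 'k) \<Longrightarrow> set js = {..<k}" by (rule supp)
  show "set js \<subseteq> {..k} \<Longrightarrow> koszul (\<lambda>_. 1) (simplex_cocycle k) js \<noteq> (0 :: 'k) \<Longrightarrow> {..k} \<subseteq> set js"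
    by (rule step[OF supp])
qed

text \<open>This nonzero value shows that the cocycle does not bound. The decreasing order puts the
  newest vertex at the head: \<open>simplex_cocycle (Suc k)\<close> vanishes on lists containing it,
  so only the leading term, which has no sign, survives.\<close>

lemma koszul_simplex_cocycle_rev:
  "koszul (\<lambda>_. 1) (simplex_cocycle k) (rev [0..<Suc k]) = (1 :: 'k::comm_ring_1)"
proof (induction k)
  case 0
  show ?case by simp
next
  case (Suc k)
  have "koszul (\<lambda>_. 1) (\<lambda>l. simplex_cocycle (Suc k) (Suc k # l)) (rev [0..<Suc k])
      = koszul (\<lambda>_. 1) (\<lambda>l. 0 :: 'k) (rev [0..<Suc k])"
    by (rule koszul_cong[OF subset_UNIV]) simp
  moreover have "simplex_cocycle (Suc k) (rev [0..<Suc k])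
      = koszul (\<lambda>_. 1 :: 'k) (simplex_cocycle k) (rev [0..<Suc k])"
    by (auto simp: less_Suc_eq_le)
  ultimately show ?case
    using Suc by (simp add: koszul_zero del: simplex_cocycle.simps)
qed

section \<open>Simplicial cochains inside the Koszul complex\<close>

definition list_exps :: "nat list \<Rightarrow> nat \<Rightarrow>\<^sub>0 nat"
  where "list_exps js = (\<Sum>j\<leftarrow>js. single j 1)"

lemma list_exps_simps [simp]:
  "list_exps [] = 0" "list_exps (j # js) = single j 1 + list_exps js"
  by (simp_all add: list_exps_def)

lemma keys_list_exps: "keys (list_exps js) = set js"
proof (induction js)
  case (Cons j js)
  have "keys (a + b) = keys a \<union> keys b" for a b :: "nat \<Rightarrow>\<^sub>0 nat"
    by (auto simp: in_keys_iff lookup_add)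
  with Cons show ?case by simp
qed simp

text \<open>Multiplication by \<open>mvar j\<close> is precisely the change of exponent caused by
  adding \<open>j\<close> to the list. On such homogeneous cochains the Koszul differential is thus
  the simplicial one, applied to coefficients.\<close>

lemma koszul_single_list_exps:
  "koszul mvar (\<lambda>l. single (W + list_exps l) (c (map f l))) js
    = (single (W + list_exps js) (koszul (\<lambda>_. 1) c (map f js)) :: 'k::field mpoly)"
proof (induction js arbitrary: W c)
  case (Cons j js)
  have "koszul mvar (\<lambda>l. single (W + list_exps (j # l)) (c (map f (j # l)))) js
      = koszul mvar (\<lambda>l. single ((W + single j 1) + list_exps l) ((\<lambda>l. c (f j # l)) (map f l)) :: 'k mpoly) js"
    by (simp add: add.assoc)
  also have "\<dots> = single ((W + single j 1) + list_exps js) (koszul (\<lambda>_. 1) (\<lambda>l. c (f j # l)) (map f js))"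
    by (rule Cons.IH)
  moreover have "mvar j * single b k = single (single j 1 + b) k" for b and k :: 'k
    by (simp add: mvar_def mult_single)
  ultimately show ?case
    by (simp add: single_diff add_ac)
qed simp

text \<open>The converse passage, for cochains that need not be homogeneous: reading off one
  coefficient per list commutes with the differentials. It turns an arbitrary candidate for bounding
  into a simplicial cochain.\<close>

lemma lookup_koszul_list_exps:
  fixes u :: "nat list \<Rightarrow> 'k::field mpoly"
  shows "lookup (koszul mvar u (map f ks)) (W + list_exps (map f ks))
    = koszul (\<lambda>_. 1) (\<lambda>l. lookup (u (map f l)) (W + list_exps (map f l))) ks"
proof (induction ks arbitrary: W u)
  case (Cons k ks)
  have e: "W + list_exps (map f (k # ks)) = single (f k) 1 + (W + list_exps (map f ks))"
    by (simp add: add_ac)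
  have "lookup (mvar (f k) * u (map f ks)) (W + list_exps (map f (k # ks))) = lookup (u (map f ks)) (W + list_exps (map f ks))"
    unfolding e mvar_def lookup_single_mult_add by simp
  moreover have "lookup (koszul mvar (\<lambda>l. u (f k # l)) (map f ks)) (W + list_exps (map f (k # ks)))
      = koszul (\<lambda>_. 1) (\<lambda>l. lookup (u (map f (k # l))) (W + list_exps (map f (k # l)))) ks"
    using Cons.IH[of "\<lambda>l. u (f k # l)" "W + single (f k) 1"] by (simp add: add.assoc)
  ultimately show ?case by (simp add: lookup_minus del: list_exps_simps)
qed simp

lemma list_exps_transversal_iff:
  assumes "set js \<subseteq> {1..n}"
  shows "list_exps js \<in> transversal n d \<longleftrightarrow> {..<d} \<subseteq> (\<lambda>j. (j - 1) mod d) ` set js"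
  using assms unfolding transversal_def by (auto simp: exps_def keys_list_exps)

lemma cohomology_nonzero_transversal:
  assumes A: "up_closed n A" and W: "W \<in> exps {1..n}" and d: "d \<le> n"
    and colon: "\<And>b. b \<in> exps {1..n} \<Longrightarrow> W + b \<in> A \<longleftrightarrow> b \<in> transversal n d"
    and dk: "d = Suc k"
  shows "cohomology_nonzero n (mono_span A :: 'k::field mpoly set) k"
proof -
  define cl where "cl j = (j - 1) mod d" for j
  \<comment> \<open>The simplex cocycle pulled back along the map from variables to classes. For
    \<open>d = 1\<close> this is just the monomial \<open>x^W\<close>, which all variables multiply
    into the ideal.\<close>
  define z where "z l = (single (W + list_exps l) (simplex_cocycle k (map cl l)) :: 'k mpoly)" for l
  have e: "list_exps js \<in> exps {1..n}" if "set js \<subseteq> {1..n}" for js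
    using that by (simp add: exps_def keys_list_exps)
  have WA: "W + list_exps js \<in> A \<longleftrightarrow> {..<d} \<subseteq> set (map cl js)" if "set js \<subseteq> {1..n}" for js
    using colon[OF e[OF that]] list_exps_transversal_iff[OF that, of d] by (simp add: cl_def[abs_def])
  have zS: "z js \<in> mono_span (exps {1..n})" if "set js \<subseteq> {1..n}" for js
    unfolding z_def by (intro mono_span_single exps_add W e that)
  have zA: "koszul mvar z js \<in> mono_span A" if "set js \<subseteq> {1..n}" "length js = Suc k" for js
  proof -
    define r where "r = koszul (\<lambda>_. 1 :: 'k) (simplex_cocycle k) (map cl js)"
    have eq: "koszul mvar z js = single (W + list_exps js) r"
      unfolding z_def r_def by (rule koszul_single_list_exps)
    show ?thesis
    proof (cases "r = 0")
      case False
      have "set (map cl js) \<subseteq> {..k}"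
        by (auto simp: cl_def dk simp flip: less_Suc_eq_le)
      then have "{..k} \<subseteq> set (map cl js)"
        using False unfolding r_def by (rule simplex_cocycle_support(2))
      then have "W + list_exps js \<in> A"
        using WA[OF that(1)] by (simp add: dk lessThan_Suc_atMost)
      then show ?thesis unfolding eq by (rule mono_span_single)
    qed (simp add: eq)
  qed
  have nb: False
    if u: "\<And>js. set js \<subseteq> {1..n} \<Longrightarrow> length js = k \<Longrightarrow> z js - koszul mvar u js \<in> mono_span A" for u
  proof -
    \<comment> \<open>The variable with index \<open>c + 1\<close> represents the class
      \<open>c\<close>, so \<open>Suc\<close> is a section of \<open>cl\<close>.\<close>
    define v where "v l = lookup (u (map Suc l)) (W + list_exps (map Suc l))" for l
    have "simplex_cocycle k ks = koszul (\<lambda>_. 1) v ks" if ks: "set ks \<subseteq> {..k}" "length ks = k" for ks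
    proof -
      have js: "set (map Suc ks) \<subseteq> {1..n}" using ks(1) d dk by auto
      have cl: "map cl (map Suc ks) = ks"
        unfolding map_map using ks(1) by (intro map_idI) (auto simp: cl_def dk)
      \<comment> \<open>A list of \<open>k = d - 1\<close> entries misses a class, so its exponent
        is outside \<open>A\<close> and the congruence modulo the ideal is an equality of
        coefficients.\<close>
      have "card (set ks) < card {..<d}" using card_length[of ks] ks(2) dk by simp
      then have "\<not> {..<d} \<subseteq> set ks" using card_mono[of "set ks" "{..<d}"] by auto
      then have "W + list_exps (map Suc ks) \<notin> A" unfolding WA[OF js] cl .
      then have "lookup (z (map Suc ks)) (W + list_exps (map Suc ks))
          = lookup (koszul mvar u (map Suc ks)) (W + list_exps (map Suc ks))"
        using u[OF js] ks(2) by (simp add: mono_span_iff lookup_minus)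
      then show ?thesis
        unfolding lookup_koszul_list_exps z_def cl v_def by simp
    qed
    then have "koszul (\<lambda>_. 1) (simplex_cocycle k) (rev [0..<Suc k])
        = koszul (\<lambda>_. 1) (koszul (\<lambda>_. 1) v) (rev [0..<Suc k])"
      by (intro koszul_cong[where J = "{..k}"]) auto
    then show False by (simp only: koszul_simplex_cocycle_rev koszul_koszul one_neq_zero)
  qed
  show ?thesis
  proof (rule cohomology_nonzeroI[of n z])
    fix u assume u: "\<And>js. set js \<subseteq> {1..n} \<Longrightarrow> length js = k \<Longrightarrow> z js - koszul mvar u js \<in> mono_span A"
    show False by (rule nb[of u]; fact u)
  qed (fact zS zA)+
qed

theorem theorem2p5:
  fixes n m d t\<^sub>0 :: nat
    and S :: "'k::field mpoly ring"
    and J U :: "'k mpoly set"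
  assumes "2 \<le> m" and "m < n"
    and "S = mpoly_ring n"
    and "J = cycle_path_ideal n m"
    and "d = gcd n m"
    and "t\<^sub>0 = threshold n m"
    and "U = residue_class_ideal n d"
  shows
    "(d = 1 \<longrightarrow> (\<forall>t\<ge>t\<^sub>0.
        quotient_sdepth n (ideal_power S J t) = quotient_depth n (ideal_power S J t) \<and>
        quotient_depth n (ideal_power S J t) = 0)) \<and>
     (d > 1 \<longrightarrow> (\<forall>t\<ge>t\<^sub>0.
        quotient_depth n (ideal_power S J t) \<le> enat (d - 1))) \<and>
     (d > 1 \<longrightarrow> (\<forall>t\<ge>t\<^sub>0.
        quotient_sdepth n (ideal_power S J t) \<le> quotient_sdepth n U \<and>
        quotient_sdepth n U \<le> enat (n - n div d)))"
proof -
  have n: "0 < n" and d: "0 < d" "d dvd n" using assms(1,2,5) by auto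
  then have dn: "d \<le> n" by (simp add: dvd_imp_le)
  define T where "T = transversal n d"
  define P where "P t = exps_power n (path_exps n m) t" for t
  have P: "ideal_power S J t = mono_span (P t)" for t
    unfolding assms(3,4) cycle_path_ideal_eq[OF n] P_def
    by (rule ideal_power_mono_span[OF up_closed_path_exps[OF n]])
  have upP: "up_closed n (P t)" for t
    unfolding P_def by (intro up_closed_exps_power up_closed_path_exps n)
  have upT: "up_closed n T" unfolding T_def by (rule up_closed_transversal)
  have U: "U = mono_span T"
    unfolding assms(7) T_def by (rule residue_class_ideal_eq[OF d(2,1)])
  have T_iff: "b \<in> T \<longleftrightarrow> b \<in> exps {1..n} \<and> (\<forall>c<d. \<exists>i\<in>keys b. (i - 1) mod d = c)" for b
    by (simp add: T_def transversal_def)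
  have le_U: "quotient_sdepth n (ideal_power S J t) \<le> quotient_sdepth n U" if t: "t\<^sub>0 \<le> t" for t
  proof -
    obtain W where W: "W \<in> exps {1..n}" and "\<And>b. b \<in> exps {1..n} \<Longrightarrow> W + b \<in> P t \<longleftrightarrow> b \<in> T"
      using path_exps_power_colon[OF assms(1,2)] t unfolding assms(5,6) P_def T_def by blast
    then have "{c \<in> exps {1..n}. W + c \<in> P t} = T" using T_iff by blast
    then show ?thesis using quotient_sdepth_colon[OF upP W, of t] unfolding P U by simp
  qed
  have depth: "quotient_depth n (ideal_power S J t) \<le> enat (d - 1)" if t: "t\<^sub>0 \<le> t" for t
  proof -
    obtain W where W: "W \<in> exps {1..n}" and WT: "\<And>b. b \<in> exps {1..n} \<Longrightarrow> W + b \<in> P t \<longleftrightarrow> b \<in> T"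
      using path_exps_power_colon[OF assms(1,2)] t unfolding assms(5,6) P_def T_def by blast
    have "cohomology_nonzero n (mono_span (P t) :: 'k mpoly set) (d - 1)"
      using d(1) WT by (intro cohomology_nonzero_transversal[OF upP W dn]) (simp_all add: T_def)
    then show ?thesis unfolding P by (rule quotient_depth_le[OF ideal_mono_span[OF upP]])
  qed
  have sdepth: "quotient_sdepth n U \<le> enat (n - n div d)"
  proof -
    \<comment> \<open>The monomial \<open>x_1 ... x_(d-1)\<close> misses exactly the last class;
      \<open>X\<close> consists of the \<open>n div d\<close> variables of that class, each of which
      completes a transversal.\<close>
    define b :: "nat \<Rightarrow>\<^sub>0 nat" where "b = list_exps [1..<d]"
    define X where "X = (\<lambda>q. d * q + d) ` {..<n div d}"
    have kb: "keys b = {1..<d}" by (simp add: b_def keys_list_exps)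
    then have be: "b \<in> exps {1..n}" using dn by (auto simp: exps_def)
    have "\<not> (\<exists>i\<in>keys b. (i - 1) mod d = d - 1)" unfolding kb by auto
    then have "b \<notin> T" using d(1) unfolding T_iff by (metis diff_less zero_less_one)
    have X: "X \<subseteq> {1..n}"
    proof
      fix x assume "x \<in> X"
      then obtain q where q: "x = d * q + d" "q < n div d" by (auto simp: X_def)
      then have "d * Suc q \<le> d * (n div d)" by (intro mult_le_mono2) simp
      then show "x \<in> {1..n}" using q d by simp
    qed
    have bX: "b + single i 1 \<in> T" if i: "i \<in> X" for i
    proof -
      obtain q where q: "i = d * q + d" using i by (auto simp: X_def)
      have "\<exists>j\<in>keys (b + single i 1). (j - 1) mod d = c" if c: "c < d" for c
      proof (cases "c = d - 1")
        case True
        have "i - 1 = d * q + (d - 1)" using q d by simp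
        then have "(i - 1) mod d = c" using c True by (simp only: mod_mult_self4 mod_less)
        then show ?thesis by (intro bexI[of _ i]) (simp_all add: in_keys_iff lookup_add)
      next
        case False
        then have "Suc c \<in> keys b" using c unfolding kb by simp
        then show ?thesis using c by (intro bexI[of _ "Suc c"]) (simp_all add: in_keys_iff lookup_add)
      qed
      moreover have "b + single i 1 \<in> exps {1..n}"
        using i X by (intro exps_add be exps_single) blast
      ultimately show ?thesis unfolding T_iff by blast
    qed
    have "card X = n div d"
      unfolding X_def using d(1) by (subst card_image) (auto simp: inj_on_def)
    then show ?thesis
      unfolding U using quotient_sdepth_le[OF upT be \<open>b \<notin> T\<close> X bX] by simp
  qed
  show ?thesis
  proof (intro conjI impI allI)
    fix t assume "d = 1" and t: "t\<^sub>0 \<le> t"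
    have "quotient_sdepth n (ideal_power S J t) \<le> enat (n - n div d)"
      using le_U[OF t] sdepth by (rule order_trans)
    \<comment> \<open>For \<open>d = 1\<close> the bound \<open>n - n div d\<close> is 0, as is the
      depth bound \<open>d - 1\<close> below.\<close>
    then have "quotient_sdepth n (ideal_power S J t) = 0" using \<open>d = 1\<close> by (simp flip: zero_enat_def)
    moreover show "quotient_depth n (ideal_power S J t) = 0"
      using depth[OF t] \<open>d = 1\<close> by (simp flip: zero_enat_def)
    ultimately show "quotient_sdepth n (ideal_power S J t) = quotient_depth n (ideal_power S J t)"
      by simp
  qed (use depth le_U sdepth in blast)+
qed

end
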